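(* The variety of $2$-dimensional pre-Poisson algebras over $\mathbb C$ has exactly five irreducible components: the closures $\overline{O(P_{07})}$, $\overline{O(P_{08})}$, $\overline{O(P_{10})}$ (with $P_{07},P_{08},P_{10}$ rigid, i.e. having open orbits), $\overline{\bigcup_{\alpha\in\mathbb C}O(P_{05}^{\alpha})}$ and $\overline{\bigcup_{\alpha\in\mathbb C}O(P_{06}^{\alpha})}$.
   Context: A pre-Poisson algebra is a complex vector space with a (left) Zinbiel product $\cdot$, i.e. a bilinear product with $x\cdot(y\cdot z)=(y\cdot x+x\cdot y)\cdot z$, and a (left) pre-Lie product $\circ$, i.e. a bilinear product with $(x\circ y)\circ z-(y\circ x)\circ z=x\circ(y\circ z)-y\circ(x\circ z)$, such that $(x\circ y-y\circ x)\cdot z=x\circ(y\cdot z)-y\cdot(x\circ z)$ and $(x\cdot y+y\cdot x)\circ z=x\cdot(y\circ z)+y\cdot(x\circ z)$. Fix a $2$-dimensional complex vector space $V$ with basis $e_1,e_2$. The variety of $2$-dimensional pre-Poisson algebras is the Zariski closed set of pairs $(\mu,\mu')\in \mathrm{Bil}(V\times V,V)^2\cong\mathbb C^{16}$ such that $\mu$ (as $\cdot$) and $\mu'$ (as $\circ$) define such an algebra. $\mathrm{GL}(V)$ acts on it by $(g*(\mu,\mu'))(x,y)=(g\mu(g^{-1}x,g^{-1}y),\,g\mu'(g^{-1}x,g^{-1}y))$; $O(T)$ denotes the orbit of (a structure representing) the algebra $T$, and closures are Zariski closures. The algebras are (unlisted products are zero; $\cdot=0$ in all but $P_{10}$): $P_{05}^{\alpha}: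 e_1\circ e_1=e_1,\ e_1\circ e_2=\alpha e_2$; $P_{06}^{\alpha}: e_1\circ e_1=e_1,\ e_1\circ e_2=\alpha e_2,\ e_2\circ e_1=e_2$; $P_{07}: e_1\circ e_1=e_1,\ e_2\circ e_2=e_2$; $P_{08}: e_1\circ e_1=e_1,\ e_1\circ e_2=2e_2,\ e_2\circ e_1=\frac12 e_1+e_2,\ e_2\circ e_2=e_2$; $P_{10}: e_1\cdot e_1=e_2,\ e_1\circ e_1=e_1,\ e_1\circ e_2=e_2,\ e_2\circ e_1=e_2$. *)

theory Defs
  imports "HOL-Analysis.Analysis"
begin

text \<open>The library's \<open>linear\<close> and \<open>bilinear\<close> are real-linear; \<open>clinear2\<close> and \<open>cbilinear\<close> below are
  linearity and bilinearity over the complex numbers.\<close>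

type_synonym V = "complex ^ 2"

type_synonym product = "V \<Rightarrow> V \<Rightarrow> V"

abbreviation clinear2 :: "(V \<Rightarrow> V) \<Rightarrow> bool" where
  "clinear2 \<equiv> Vector_Spaces.linear (*s) (*s)"

definition cbilinear :: "product \<Rightarrow> bool" where
  "cbilinear m \<longleftrightarrow> (\<forall>x. clinear2 (\<lambda>y. m x y)) \<and> (\<forall>y. clinear2 (\<lambda>x. m x y))"

definition zinbiel_product :: "product \<Rightarrow> bool" where
  "zinbiel_product m \<longleftrightarrow> cbilinear m \<and> (\<forall>x y z. m x (m y z) = m (m y x + m x y) z)"

definition pre_lie_product :: "product \<Rightarrow> bool" where
  "pre_lie_product m \<longleftrightarrow> cbilinear m \<and>
     (\<forall>x y z. m (m x y) z - m (m y x) z = m x (m y z) - m y (m x z))"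

text \<open>In a pair \<open>(d, c)\<close>, \<open>d\<close> is the Zinbiel product (dot) and \<open>c\<close> the pre-Lie product (circle).\<close>

definition pre_poisson :: "product \<times> product \<Rightarrow> bool" where
  "pre_poisson = (\<lambda>(d, c). zinbiel_product d \<and> pre_lie_product c \<and>
     (\<forall>x y z. d (c x y - c y x) z = c x (d y z) - d y (c x z)) \<and>
     (\<forall>x y z. c (d x y + d y x) z = d x (c y z) + d y (c x z)))"

definition Bil2 :: "(product \<times> product) set" where
  "Bil2 = {(d, c). cbilinear d \<and> cbilinear c}"

definition pre_poisson_variety :: "(product \<times> product) set" where
  "pre_poisson_variety = {T \<in> Bil2. pre_poisson T}"

text \<open>Polynomial functions in the 16 structure constants, the coordinates of \<open>Bil2\<close>.\<close>

inductive polynomial_function_Bil2 :: "(product \<times> product \<Rightarrow> complex) \<Rightarrow> bool" where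
  const: "polynomial_function_Bil2 (\<lambda>T. a)"
| coord_fst: "polynomial_function_Bil2 (\<lambda>T. fst T (axis i 1) (axis j 1) $ k)"
| coord_snd: "polynomial_function_Bil2 (\<lambda>T. snd T (axis i 1) (axis j 1) $ k)"
| add: "polynomial_function_Bil2 f \<Longrightarrow> polynomial_function_Bil2 g \<Longrightarrow>
          polynomial_function_Bil2 (\<lambda>T. f T + g T)"
| mult: "polynomial_function_Bil2 f \<Longrightarrow> polynomial_function_Bil2 g \<Longrightarrow>
          polynomial_function_Bil2 (\<lambda>T. f T * g T)"

definition zero_locus :: "(product \<times> product \<Rightarrow> complex) set \<Rightarrow> (product \<times> product) set" where
  "zero_locus F = {T \<in> Bil2. \<forall>f\<in>F. f T = 0}"

definition zariski_closed :: "(product \<times> product) set \<Rightarrow> bool" where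
  "zariski_closed Z \<longleftrightarrow> (\<exists>F. (\<forall>f\<in>F. polynomial_function_Bil2 f) \<and> Z = zero_locus F)"

definition zariski :: "(product \<times> product) topology" where
  "zariski = topology (\<lambda>U. U \<subseteq> Bil2 \<and> zariski_closed (Bil2 - U))"

lemma zero_locus_Un:
  "zero_locus F \<union> zero_locus G = zero_locus ((\<lambda>(f, g). \<lambda>T. f T * g T) ` (F \<times> G))"
proof (rule set_eqI)
  fix T
  have "T \<in> zero_locus ((\<lambda>(f, g). \<lambda>T. f T * g T) ` (F \<times> G)) \<longleftrightarrow>
      T \<in> Bil2 \<and> (\<forall>p\<in>F \<times> G. fst p T * snd p T = 0)"
    by (simp only: zero_locus_def mem_Collect_eq ball_simps case_prod_unfold)
  also have "\<dots> \<longleftrightarrow> T \<in> Bil2 \<and> ((\<forall>f\<in>F. f T = 0) \<or> (\<forall>g\<in>G. g T = 0))"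
    by auto
  also have "\<dots> \<longleftrightarrow> T \<in> zero_locus F \<union> zero_locus G"
    unfolding zero_locus_def by blast
  finally show "T \<in> zero_locus F \<union> zero_locus G \<longleftrightarrow>
      T \<in> zero_locus ((\<lambda>(f, g). \<lambda>T. f T * g T) ` (F \<times> G))" by (rule sym)
qed

lemma zariski_closed_Un:
  assumes "zariski_closed A" "zariski_closed B"
  shows "zariski_closed (A \<union> B)"
proof -
  obtain F where F: "\<forall>f\<in>F. polynomial_function_Bil2 f" "A = zero_locus F"
    using assms(1) unfolding zariski_closed_def by (elim exE conjE)
  obtain G where G: "\<forall>g\<in>G. polynomial_function_Bil2 g" "B = zero_locus G"
    using assms(2) unfolding zariski_closed_def by (elim exE conjE)
  let ?H = "(\<lambda>(f, g). \<lambda>T. f T * g T) ` (F \<times> G)"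
  have "\<forall>h\<in>?H. polynomial_function_Bil2 h"
  proof
    fix h assume "h \<in> ?H"
    then obtain f g where fg: "f \<in> F" "g \<in> G" and h: "h = (\<lambda>T. f T * g T)"
      by (elim imageE SigmaE) simp
    show "polynomial_function_Bil2 h"
      unfolding h using fg F(1) G(1) by (intro polynomial_function_Bil2.mult) simp_all
  qed
  moreover have "A \<union> B = zero_locus ?H"
    unfolding F(2) G(2) by (rule zero_locus_Un)
  ultimately show ?thesis unfolding zariski_closed_def by (intro exI conjI)
qed

lemma zariski_closed_Inter:
  assumes "\<And>A. A \<in> K \<Longrightarrow> zariski_closed A"
  shows "zariski_closed (Bil2 \<inter> \<Inter>K)"
proof -
  have "\<forall>A\<in>K. \<exists>F. (\<forall>f\<in>F. polynomial_function_Bil2 f) \<and> A = zero_locus F"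
    using assms unfolding zariski_closed_def by simp
  then have "\<exists>F. \<forall>A\<in>K. (\<forall>f\<in>F A. polynomial_function_Bil2 f) \<and> A = zero_locus (F A)"
    by (rule bchoice)
  then obtain F where F: "\<forall>A\<in>K. (\<forall>f\<in>F A. polynomial_function_Bil2 f) \<and> A = zero_locus (F A)" ..
  have mem: "T \<in> A \<longleftrightarrow> T \<in> zero_locus (F A)" if "A \<in> K" for T A
    using bspec[OF F that] by (elim conjE) (rule arg_cong[where f = "\<lambda>B. T \<in> B"])
  have "Bil2 \<inter> \<Inter>K = zero_locus (\<Union>A\<in>K. F A)"
  proof (rule set_eqI)
    fix T
    have "T \<in> Bil2 \<inter> \<Inter>K \<longleftrightarrow> T \<in> Bil2 \<and> (\<forall>A\<in>K. T \<in> zero_locus (F A))"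
      using mem by simp
    also have "\<dots> \<longleftrightarrow> T \<in> zero_locus (\<Union>A\<in>K. F A)"
      unfolding zero_locus_def by auto
    finally show "T \<in> Bil2 \<inter> \<Inter>K \<longleftrightarrow> T \<in> zero_locus (\<Union>A\<in>K. F A)" .
  qed
  moreover have "\<forall>f\<in>(\<Union>A\<in>K. F A). polynomial_function_Bil2 f"
    using F by (meson UN_E)
  ultimately show ?thesis unfolding zariski_closed_def by (intro exI conjI)
qed

lemma istopology_zariski: "istopology (\<lambda>U. U \<subseteq> Bil2 \<and> zariski_closed (Bil2 - U))"
  unfolding istopology_def
proof (intro conjI allI impI)
  fix S T assume "S \<subseteq> Bil2 \<and> zariski_closed (Bil2 - S)" "T \<subseteq> Bil2 \<and> zariski_closed (Bil2 - T)"
  then show "S \<inter> T \<subseteq> Bil2" "zariski_closed (Bil2 - S \<inter> T)"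
    using zariski_closed_Un[of "Bil2 - S" "Bil2 - T"] by (blast, simp only: Diff_Int)
next
  fix K assume K: "\<forall>S\<in>K. S \<subseteq> Bil2 \<and> zariski_closed (Bil2 - S)"
  then show "\<Union>K \<subseteq> Bil2" by blast
  have "Bil2 - \<Union>K = Bil2 \<inter> \<Inter>((\<lambda>S. Bil2 - S) ` K)" by auto
  then show "zariski_closed (Bil2 - \<Union>K)"
    using zariski_closed_Inter[of "(\<lambda>S. Bil2 - S) ` K"] K by (simp only: imageE) (metis imageE)
qed

lemma openin_zariski: "openin zariski U \<longleftrightarrow> U \<subseteq> Bil2 \<and> zariski_closed (Bil2 - U)"
  unfolding zariski_def by (simp add: topology_inverse'[OF istopology_zariski])

lemma topspace_zariski: "topspace zariski = Bil2"
proof -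
  have "zero_locus {\<lambda>T. 1} = {}" by (simp add: zero_locus_def)
  then have "zariski_closed {}"
    unfolding zariski_closed_def
    by (intro exI[of _ "{\<lambda>T. 1}"]) (simp add: polynomial_function_Bil2.const)
  then have "openin zariski Bil2" by (simp add: openin_zariski)
  moreover have "topspace zariski \<subseteq> Bil2"
    using openin_topspace[of zariski] unfolding openin_zariski by blast
  ultimately show ?thesis by (simp add: openin_subset subset_antisym)
qed

lemma closedin_zariski: "closedin zariski Z \<longleftrightarrow> zariski_closed Z"
proof -
  have "Z \<subseteq> Bil2" if "zariski_closed Z"
    using that unfolding zariski_closed_def zero_locus_def by auto
  then show ?thesis
    unfolding closedin_def topspace_zariski openin_zariski by (simp add: double_diff conj_commute cong: conj_cong)
qed

definition irreducible_in :: "'a topology \<Rightarrow> 'a set \<Rightarrow> bool" where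
  "irreducible_in X S \<longleftrightarrow> S \<subseteq> topspace X \<and> S \<noteq> {} \<and>
     (\<forall>A B. closedin X A \<and> closedin X B \<and> S \<subseteq> A \<union> B \<longrightarrow> S \<subseteq> A \<or> S \<subseteq> B)"

definition irreducible_components :: "'a topology \<Rightarrow> 'a set set" where
  "irreducible_components X =
     {S. irreducible_in X S \<and> (\<forall>S'. irreducible_in X S' \<and> S \<subseteq> S' \<longrightarrow> S' = S)}"

definition act :: "(V \<Rightarrow> V) \<Rightarrow> product \<times> product \<Rightarrow> product \<times> product" where
  "act g = (\<lambda>(d, c). (\<lambda>x y. g (d (inv g x) (inv g y)), \<lambda>x y. g (c (inv g x) (inv g y))))"

definition orbit :: "product \<times> product \<Rightarrow> (product \<times> product) set" where
  "orbit T = {act g T | g. clinear2 g \<and> bij g}"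

definition rigid :: "product \<times> product \<Rightarrow> bool" where
  "rigid T \<longleftrightarrow> T \<in> pre_poisson_variety \<and>
     openin (subtopology zariski pre_poisson_variety) (orbit T)"

abbreviation e1 :: V where "e1 \<equiv> axis 1 1"
abbreviation e2 :: V where "e2 \<equiv> axis 2 1"

text \<open>\<open>mult_table a b c d\<close> is the bilinear product taking \<open>(e1,e1)\<close>, \<open>(e1,e2)\<close>, \<open>(e2,e1)\<close>, \<open>(e2,e2)\<close>
  to \<open>a\<close>, \<open>b\<close>, \<open>c\<close>, \<open>d\<close>.\<close>

definition mult_table :: "V \<Rightarrow> V \<Rightarrow> V \<Rightarrow> V \<Rightarrow> product" where
  "mult_table a b c d = (\<lambda>x y.
     (x $ 1 * y $ 1) *s a + (x $ 1 * y $ 2) *s b + (x $ 2 * y $ 1) *s c + (x $ 2 * y $ 2) *s d)"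

definition P05 :: "complex \<Rightarrow> product \<times> product" where
  "P05 \<alpha> = (mult_table 0 0 0 0, mult_table e1 (\<alpha> *s e2) 0 0)"

definition P06 :: "complex \<Rightarrow> product \<times> product" where
  "P06 \<alpha> = (mult_table 0 0 0 0, mult_table e1 (\<alpha> *s e2) e2 0)"

definition P07 :: "product \<times> product" where
  "P07 = (mult_table 0 0 0 0, mult_table e1 0 0 e2)"

definition P08 :: "product \<times> product" where
  "P08 = (mult_table 0 0 0 0, mult_table e1 (2 *s e2) ((1/2) *s e1 + e2) e2)"

definition P10 :: "product \<times> product" where
  "P10 = (mult_table e2 0 0 0, mult_table e1 e2 e2 0)"

end

theory Submission
  imports Defs
begin

text \<open>
  Normal forms of the structures are found by elementary coordinate computations: a nonzero
  Zinbiel product has a cyclic vector and forces the \<open>zinbiel_form\<close> family; a commutative pre-Lie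
  product is zero or cyclic; for a noncommutative one a frame with \<open>[u, v] = v\<close> is chosen. A one-parameter
  deformation of each normal form lies generically in one of the five orbit families, so their closures
  cover the variety. The families are irreducible because any two of their points lie on a
  rational curve. Vanishing conditions on commutators, traces and determinants of the multiplication
  operators and on mixed products give invariant closed sets; these separate the five closures, and the
  open orbits are complements of unions of them.
\<close>

section \<open>Bilinear products in coordinates\<close>

text \<open>The closures are not computed: each is only bounded from above by two invariant closed
  loci, chosen so that together they exclude one sample structure of each of the other four sets;
  \<open>P05 1\<close> and \<open>P06 0\<close> are the samples of the two families. Degenerations
  are not realised by curves in the group either. The parameters of a normal form are moved along an
  affine line, and for all but finitely many values an explicit pair of vectors identifies the
  result with a listed structure. Degenerate structures, such as those where left multiplication by
  \<open>e1\<close> has a Jordan block, thus appear only as limits. Accordingly the classification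
  may be coarse: different parameters of a normal form may give isomorphic structures, since every
  structure only has to be placed in some closure.\<close>

lemma clinear2D:
  assumes "clinear2 g"
  shows "g (x + y) = g x + g y" "g (a *s x) = a *s g x" "g 0 = 0"
    "g (x - y) = g x - g y"
proof -
  interpret Vector_Spaces.linear "(*s)" "(*s)" g by fact
  show "g (x + y) = g x + g y" "g (a *s x) = a *s g x" "g 0 = 0" "g (x - y) = g x - g y"
    by (simp_all add: add scale zero diff)
qed

lemma clinear2I:
  assumes "\<And>x y. g (x + y) = g x + g y" "\<And>a x. g (a *s x) = a *s g x"
  shows "clinear2 g"
  by unfold_locales (simp_all add: assms algebra_simps)

lemma vec2_eq_iff: "(x::V) = y \<longleftrightarrow> x $ 1 = y $ 1 \<and> x $ 2 = y $ 2"
  by (simp add: vec_eq_iff forall_2)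

lemma axis_components [simp]:
  "(e1 :: V) $ 1 = 1" "(e1 :: V) $ 2 = 0" "(e2 :: V) $ 1 = 0" "(e2 :: V) $ 2 = 1"
  by (simp_all add: axis_def)

lemma V_expand: "(x::V) = x $ 1 *s e1 + x $ 2 *s e2"
  by (simp add: vec2_eq_iff)

lemma cbilinear_mult_table [simp]: "cbilinear (mult_table a b c d)"
  unfolding cbilinear_def mult_table_def
  by (intro conjI allI clinear2I) (simp_all add: vec2_eq_iff algebra_simps)

lemma cbilinearD:
  assumes "cbilinear m"
  shows "m (x + y) z = m x z + m y z" "m z (x + y) = m z x + m z y"
    "m (a *s x) z = a *s m x z" "m z (a *s x) = a *s m z x"
proof -
  have "clinear2 (\<lambda>x. m x y)" "clinear2 (m y)" for y
    using assms by (simp_all add: cbilinear_def)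
  from clinear2D[OF this(1)] clinear2D[OF this(2)]
  show "m (x + y) z = m x z + m y z" "m z (x + y) = m z x + m z y"
    "m (a *s x) z = a *s m x z" "m z (a *s x) = a *s m z x"
    by simp_all
qed

lemma cbilinear_expand:
  assumes "cbilinear m"
  shows "m x y = (x $ 1 * y $ 1) *s m e1 e1 + (x $ 1 * y $ 2) *s m e1 e2
               + (x $ 2 * y $ 1) *s m e2 e1 + (x $ 2 * y $ 2) *s m e2 e2"
proof -
  have "m x y = m (x $ 1 *s e1 + x $ 2 *s e2) (y $ 1 *s e1 + y $ 2 *s e2)"
    using V_expand[of x] V_expand[of y] by simp
  then show ?thesis
    by (simp add: cbilinearD[OF assms] vec2_eq_iff algebra_simps)
qed

lemma cbilinear_eq_mult_table:
  assumes "cbilinear m"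
  shows "m = mult_table (m e1 e1) (m e1 e2) (m e2 e1) (m e2 e2)"
  by (intro ext) (simp add: mult_table_def cbilinear_expand[OF assms, symmetric])

lemma mult_table_basis [simp]:
  "mult_table a b c d e1 e1 = a" "mult_table a b c d e1 e2 = b"
  "mult_table a b c d e2 e1 = c" "mult_table a b c d e2 e2 = d"
  by (simp_all add: mult_table_def vec2_eq_iff)

lemma mult_table_zero: "mult_table 0 0 0 0 = (\<lambda>x y. 0)"
  by (simp add: mult_table_def vec2_eq_iff fun_eq_iff)

lemma Bil2_iff: "T \<in> Bil2 \<longleftrightarrow> cbilinear (fst T) \<and> cbilinear (snd T)"
  by (cases T) (simp add: Bil2_def)

lemma mult_table_in_Bil2 [simp]: "(mult_table a b c d, mult_table a' b' c' d') \<in> Bil2"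
  by (simp add: Bil2_iff)

lemma Bil2_cases:
  assumes "T \<in> Bil2"
  obtains a b c d a' b' c' d' where "T = (mult_table a b c d, mult_table a' b' c' d')"
  using assms cbilinear_eq_mult_table[of "fst T"] cbilinear_eq_mult_table[of "snd T"]
  unfolding Bil2_iff by (metis prod.collapse)

section \<open>Frames and the action of the general linear group\<close>

definition area :: "V \<Rightarrow> V \<Rightarrow> complex" where
  "area x y = x $ 1 * y $ 2 - x $ 2 * y $ 1"

definition frame :: "V \<Rightarrow> V \<Rightarrow> V \<Rightarrow> V" where
  "frame u v = (\<lambda>x. x $ 1 *s u + x $ 2 *s v)"

text \<open>Cramer's rule for the inverse of \<open>frame u v\<close>. The explicit quotients
  display \<open>area u v\<close> as the only denominator that a change of basis introduces.\<close>

definition coframe :: "V \<Rightarrow> V \<Rightarrow> V \<Rightarrow> V" where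
  "coframe u v x = (area x v / area u v) *s e1 + (area u x / area u v) *s e2"

lemma frame_basis [simp]: "frame u v e1 = u" "frame u v e2 = v"
  by (simp_all add: frame_def vec2_eq_iff)

lemma clinear2_frame [simp]: "clinear2 (frame u v)"
  by (rule clinear2I) (simp_all add: frame_def vec2_eq_iff algebra_simps)

lemma clinear2_eq_frame:
  assumes "clinear2 g"
  shows "g = frame (g e1) (g e2)"
proof
  fix x show "g x = frame (g e1) (g e2) x"
    by (subst V_expand[of x]) (simp add: clinear2D[OF assms] frame_def)
qed

lemma area_frame: "area (frame u v x) (frame u v y) = area u v * area x y"
  by (simp add: area_def frame_def algebra_simps)

lemma frame_coframe: "area u v \<noteq> 0 \<Longrightarrow> frame u v (coframe u v x) = x"
  by (simp add: coframe_def frame_def vec2_eq_iff divide_simps) (simp add: area_def algebra_simps)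

lemma coframe_frame: "area u v \<noteq> 0 \<Longrightarrow> coframe u v (frame u v x) = x"
  by (simp add: coframe_def frame_def vec2_eq_iff divide_simps) (simp add: area_def algebra_simps)

lemma bij_frame: "area u v \<noteq> 0 \<Longrightarrow> bij (frame u v)"
  by (rule bij_betw_byWitness[where f' = "coframe u v"]) (auto simp: frame_coframe coframe_frame)

lemma inv_frame: "area u v \<noteq> 0 \<Longrightarrow> inv (frame u v) = coframe u v"
  by (rule inv_unique_comp) (auto simp: fun_eq_iff frame_coframe coframe_frame)

lemma area_nonzero_of_bij:
  assumes "bij (frame u v)"
  shows "area u v \<noteq> 0"
proof
  assume 0: "area u v = 0"
  have inj: "frame u v x = 0 \<Longrightarrow> x = 0" for x
    using assms clinear2D(3)[OF clinear2_frame, of u v] by (metis bij_pointE)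
  \<comment> \<open>The arguments come from the adjugate matrix, so the only possibly nonzero
    component of their images is \<open>area u v\<close> up to sign. Injectivity then kills all
    entries of \<open>u\<close> and \<open>v\<close>.\<close>
  have "frame u v (v $ 2 *s e1 - u $ 2 *s e2) = 0" "frame u v (v $ 1 *s e1 - u $ 1 *s e2) = 0"
    using 0 by (simp_all add: frame_def vec2_eq_iff area_def algebra_simps)
  from this[THEN inj] have "u = 0" by (simp add: vec2_eq_iff)
  then have "frame u v e1 = 0" by simp
  from inj[OF this] show False by (simp add: vec2_eq_iff)
qed

lemma coframe_eq_frame: "coframe u v = frame (coframe u v e1) (coframe u v e2)"
  by (auto simp: fun_eq_iff coframe_def frame_def vec2_eq_iff area_def algebra_simps
      add_divide_distrib diff_divide_distrib)

lemma orbit_frame: "orbit T = {act (frame u v) T | u v. area u v \<noteq> 0}"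
proof (intro set_eqI iffI)
  fix S assume "S \<in> orbit T"
  then obtain g where g: "clinear2 g" "bij g" "S = act g T" by (auto simp: orbit_def)
  then show "S \<in> {act (frame u v) T | u v. area u v \<noteq> 0}"
    using clinear2_eq_frame[OF g(1)] area_nonzero_of_bij by (metis (mono_tags, lifting) CollectI)
next
  fix S assume "S \<in> {act (frame u v) T | u v. area u v \<noteq> 0}"
  then show "S \<in> orbit T"
    unfolding orbit_def using clinear2_frame bij_frame by blast
qed

lemma act_frame:
  assumes "area u v \<noteq> 0"
  shows "fst (act (frame u v) T) x y = frame u v (fst T (coframe u v x) (coframe u v y))"
    "snd (act (frame u v) T) x y = frame u v (snd T (coframe u v x) (coframe u v y))"
  by (simp_all add: act_def split_beta inv_frame assms)

lemma act_frame_in_Bil2: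
  assumes "area u v \<noteq> 0" "T \<in> Bil2"
  shows "act (frame u v) T \<in> Bil2"
proof -
  have cf: "coframe u v (x + y) = coframe u v x + coframe u v y"
    "coframe u v (a *s x) = a *s coframe u v x" for x y a
    by (subst (1 2 3) coframe_eq_frame, simp add: clinear2D)
       (subst (1 2) coframe_eq_frame, simp add: clinear2D)
  show ?thesis
    using assms unfolding Bil2_iff cbilinear_def[of "fst (act _ _)"] cbilinear_def[of "snd (act _ _)"]
    by (auto intro!: clinear2I simp: act_frame cf clinear2D cbilinearD)
qed

text \<open>If \<open>u\<close>, \<open>v\<close> multiply in \<open>T\<close> as \<open>e1\<close>,
  \<open>e2\<close> do in \<open>P\<close>, then \<open>frame u v\<close> is an isomorphism from
  \<open>P\<close> to \<open>T\<close>; by bilinearity the basis products decide.\<close>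

lemma orbitI:
  assumes "T \<in> Bil2" "P \<in> Bil2" and uv: "area u v \<noteq> 0"
    and "fst T u u = frame u v (fst P e1 e1)" "fst T u v = frame u v (fst P e1 e2)"
      "fst T v u = frame u v (fst P e2 e1)" "fst T v v = frame u v (fst P e2 e2)"
    and "snd T u u = frame u v (snd P e1 e1)" "snd T u v = frame u v (snd P e1 e2)"
      "snd T v u = frame u v (snd P e2 e1)" "snd T v v = frame u v (snd P e2 e2)"
  shows "T \<in> orbit P"
proof -
  have *: "m x y = frame u v (p (coframe u v x) (coframe u v y))"
    if mp: "cbilinear m" "cbilinear p" and "m u u = frame u v (p e1 e1)" "m u v = frame u v (p e1 e2)"
      "m v u = frame u v (p e2 e1)" "m v v = frame u v (p e2 e2)" for m p x y
  proof -
    have "m (frame u v a) (frame u v b) = frame u v (p a b)" for a b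
      unfolding cbilinear_expand[OF mp(2), of a b] fun_cong[OF frame_def[of u v], of a] fun_cong[OF frame_def[of u v], of b]
      using that by (simp add: cbilinearD clinear2D algebra_simps vec2_eq_iff)
    from this[of "coframe u v x" "coframe u v y"] show ?thesis by (simp add: frame_coframe uv)
  qed
  have "T = act (frame u v) P"
    using assms(1,2) * [of "fst T" "fst P"] * [of "snd T" "snd P"] assms(4-)
    by (intro prod_eqI ext) (simp_all add: act_frame uv Bil2_iff)
  then show ?thesis using uv by (auto simp: orbit_frame)
qed

lemma orbit_in_Bil2: "T \<in> Bil2 \<Longrightarrow> orbit T \<subseteq> Bil2"
  by (auto simp: orbit_frame act_frame_in_Bil2)

lemma orbit_trans:
  assumes "S \<in> orbit T" "R \<in> orbit S"
  shows "R \<in> orbit T"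
proof -
  obtain g where g: "clinear2 g" "bij g" "S = act g T" using assms by (auto simp: orbit_def)
  obtain h where h: "clinear2 h" "bij h" "R = act h S" using assms by (auto simp: orbit_def)
  have "R = act (h \<circ> g) T"
    by (simp add: g h act_def split_beta o_inv_distrib)
  moreover have "clinear2 (h \<circ> g)"
    using g(1) h(1) by (intro clinear2I) (simp_all add: clinear2D)
  ultimately show ?thesis
    unfolding orbit_def using g h bij_comp by blast
qed

lemma orbit_sym:
  assumes "S \<in> orbit T"
  shows "T \<in> orbit S"
proof -
  obtain u v where uv: "area u v \<noteq> 0" "S = act (frame u v) T" using assms by (auto simp: orbit_frame)
  have "T = act (coframe u v) S"
    using uv bij_frame[of u v]
    by (simp add: act_def split_beta inv_frame[symmetric] inv_inv_eq bij_is_inj)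
  moreover have "bij (coframe u v)" "clinear2 (coframe u v)"
    using bij_imp_bij_inv[OF bij_frame[OF uv(1)]] uv(1)
    by (simp_all add: inv_frame) (metis clinear2_frame coframe_eq_frame)
  ultimately show ?thesis unfolding orbit_def by blast
qed

section \<open>Regular functions and Zariski closed sets\<close>

text \<open>\<open>T \<mapsto> fst T x y $ k\<close> with general \<open>x, y\<close> is polynomial only where \<open>fst T\<close> is bilinear,
  hence the restriction to \<open>Bil2\<close>.\<close>

definition regular :: "(product \<times> product \<Rightarrow> complex) \<Rightarrow> bool" where
  "regular f \<longleftrightarrow> (\<exists>p. polynomial_function_Bil2 p \<and> (\<forall>T\<in>Bil2. f T = p T))"

definition regularV :: "(product \<times> product \<Rightarrow> V) \<Rightarrow> bool" where
  "regularV x \<longleftrightarrow> (\<forall>k. regular (\<lambda>T. x T $ k))"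

named_theorems regular_intros

lemma regular_of_polynomial: "polynomial_function_Bil2 f \<Longrightarrow> regular f"
  unfolding regular_def by blast

lemma regular_const [regular_intros]: "regular (\<lambda>T. a)"
  by (intro regular_of_polynomial polynomial_function_Bil2.const)

lemma regular_add [regular_intros]: "regular f \<Longrightarrow> regular g \<Longrightarrow> regular (\<lambda>T. f T + g T)"
  unfolding regular_def by (metis polynomial_function_Bil2.add)

lemma regular_mult [regular_intros]: "regular f \<Longrightarrow> regular g \<Longrightarrow> regular (\<lambda>T. f T * g T)"
  unfolding regular_def by (metis polynomial_function_Bil2.mult)

lemma regular_diff [regular_intros]:
  assumes "regular f" "regular g"
  shows "regular (\<lambda>T. f T - g T)"
  using regular_add[OF assms(1) regular_mult[OF regular_const[of "-1"] assms(2)]] by simp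

lemma regular_power [regular_intros]: "regular f \<Longrightarrow> regular (\<lambda>T. f T ^ n)"
  by (induction n) (auto intro: regular_intros)

lemma regularV_component [regular_intros]: "regularV x \<Longrightarrow> regular (\<lambda>T. x T $ k)"
  by (simp add: regularV_def)

lemma regularV_const [regular_intros]: "regularV (\<lambda>T. a)"
  by (simp add: regularV_def regular_intros)

lemma regularV_add [regular_intros]: "regularV x \<Longrightarrow> regularV y \<Longrightarrow> regularV (\<lambda>T. x T + y T)"
  by (simp add: regularV_def regular_intros)

lemma regularV_diff [regular_intros]: "regularV x \<Longrightarrow> regularV y \<Longrightarrow> regularV (\<lambda>T. x T - y T)"
  by (simp add: regularV_def regular_intros)

lemma regularV_scale [regular_intros]: "regular f \<Longrightarrow> regularV x \<Longrightarrow> regularV (\<lambda>T. f T *s x T)"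
  by (simp add: regularV_def regular_intros)

lemma regular_cong:
  assumes "regular g" "\<And>T. T \<in> Bil2 \<Longrightarrow> f T = g T"
  shows "regular f"
  using assms unfolding regular_def by auto

lemma regularV_fst [regular_intros]:
  assumes "regularV x" "regularV y"
  shows "regularV (\<lambda>T. fst T (x T) (y T))"
  unfolding regularV_def
proof
  fix k
  have c: "regular (\<lambda>T. fst T (axis i 1) (axis j 1) $ k)" for i j
    by (intro regular_of_polynomial polynomial_function_Bil2.coord_fst)
  show "regular (\<lambda>T. fst T (x T) (y T) $ k)"
    by (rule regular_cong[where g = "\<lambda>T. ((x T $ 1 * y T $ 1) *s fst T e1 e1 + (x T $ 1 * y T $ 2) *s fst T e1 e2
               + (x T $ 2 * y T $ 1) *s fst T e2 e1 + (x T $ 2 * y T $ 2) *s fst T e2 e2) $ k"])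
      (simp_all add: regular_intros assms c Bil2_iff flip: cbilinear_expand)
qed

lemma regularV_snd [regular_intros]:
  assumes "regularV x" "regularV y"
  shows "regularV (\<lambda>T. snd T (x T) (y T))"
  unfolding regularV_def
proof
  fix k
  have c: "regular (\<lambda>T. snd T (axis i 1) (axis j 1) $ k)" for i j
    by (intro regular_of_polynomial polynomial_function_Bil2.coord_snd)
  show "regular (\<lambda>T. snd T (x T) (y T) $ k)"
    by (rule regular_cong[where g = "\<lambda>T. ((x T $ 1 * y T $ 1) *s snd T e1 e1 + (x T $ 1 * y T $ 2) *s snd T e1 e2
               + (x T $ 2 * y T $ 1) *s snd T e2 e1 + (x T $ 2 * y T $ 2) *s snd T e2 e2) $ k"])
      (simp_all add: regular_intros assms c Bil2_iff flip: cbilinear_expand)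
qed

lemma regular_area [regular_intros]:
  "regularV x \<Longrightarrow> regularV y \<Longrightarrow> regular (\<lambda>T. area (x T) (y T))"
  unfolding area_def by (intro regular_intros)

lemma zariski_closed_subset: "zariski_closed Z \<Longrightarrow> Z \<subseteq> Bil2"
  by (auto simp: zariski_closed_def zero_locus_def)

lemma zariski_closed_eq:
  assumes "regular f" "regular g"
  shows "zariski_closed {T \<in> Bil2. f T = g T}"
proof -
  obtain p where p: "polynomial_function_Bil2 p" "\<And>T. T \<in> Bil2 \<Longrightarrow> f T - g T = p T"
    using regular_diff[OF assms] unfolding regular_def by blast
  have "{T \<in> Bil2. f T = g T} = zero_locus {p}"
    unfolding zero_locus_def using p(2) by (auto simp flip: p(2))
  then show ?thesis using p(1) unfolding zariski_closed_def by blast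
qed

text \<open>Arbitrary intersections allow the index to range over all of \<open>V\<close>, so closed
  conditions can be stated without coordinates, where their invariance under base change is
  visible.\<close>

lemma zariski_closed_all:
  assumes "\<And>i. zariski_closed {T \<in> Bil2. P i T}"
  shows "zariski_closed {T \<in> Bil2. \<forall>i. P i T}"
proof -
  have "{T \<in> Bil2. \<forall>i. P i T} = Bil2 \<inter> \<Inter> (range (\<lambda>i. {T \<in> Bil2. P i T}))" by auto
  then show ?thesis using zariski_closed_Inter[of "range (\<lambda>i. {T \<in> Bil2. P i T})"] assms by auto
qed

lemma zariski_closed_conj:
  assumes "zariski_closed {T \<in> Bil2. P T}" "zariski_closed {T \<in> Bil2. Q T}"
  shows "zariski_closed {T \<in> Bil2. P T \<and> Q T}"
proof -
  have "{T \<in> Bil2. P T \<and> Q T} = {T \<in> Bil2. \<forall>b. if b then P T else Q T}" by (auto split: if_splits)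
  moreover have "zariski_closed {T \<in> Bil2. if b then P T else Q T}" for b
    using assms by (cases b) simp_all
  ultimately show ?thesis using zariski_closed_all[of "\<lambda>b T. if b then P T else Q T"] by simp
qed

lemma zariski_closed_eqV:
  assumes "regularV x" "regularV y"
  shows "zariski_closed {T \<in> Bil2. x T = y T}"
  unfolding vec_eq_iff using assms by (intro zariski_closed_all zariski_closed_eq regular_intros)

lemma pre_poisson_variety_eq:
  "pre_poisson_variety = {T \<in> Bil2.
     (\<forall>x y z. fst T x (fst T y z) = fst T (fst T y x + fst T x y) z) \<and>
     (\<forall>x y z. snd T (snd T x y) z - snd T (snd T y x) z = snd T x (snd T y z) - snd T y (snd T x z)) \<and>
     (\<forall>x y z. fst T (snd T x y - snd T y x) z = snd T x (fst T y z) - fst T y (snd T x z)) \<and>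
     (\<forall>x y z. snd T (fst T x y + fst T y x) z = fst T x (snd T y z) + fst T y (snd T x z))}"
  unfolding pre_poisson_variety_def pre_poisson_def zinbiel_product_def pre_lie_product_def split_beta
  by (rule Collect_cong, unfold Bil2_iff, rule iffI; elim conjE; intro conjI; assumption)

lemma zariski_closed_variety: "zariski_closed pre_poisson_variety"
  unfolding pre_poisson_variety_eq
  by (intro zariski_closed_conj zariski_closed_all zariski_closed_eqV regular_intros)

lemma mem_closure_zariski:
  assumes "S \<subseteq> Bil2"
  shows "T \<in> zariski closure_of S \<longleftrightarrow> (\<forall>Z. zariski_closed Z \<and> S \<subseteq> Z \<longrightarrow> T \<in> Z)"
  using closure_of_minimal[of S _ zariski] closedin_closure_of[of zariski S]
    closure_of_subset[of S zariski] assms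
  unfolding closedin_zariski topspace_zariski by blast

lemma closure_zariski_subset: "zariski_closed Z \<Longrightarrow> S \<subseteq> Z \<Longrightarrow> zariski closure_of S \<subseteq> Z"
  by (simp add: closure_of_minimal closedin_zariski)

text \<open>The frame is fixed, so the entries of its inverse are constants and the transported
  structure constants depend linearly on those of \<open>T\<close>.\<close>

lemma regular_pullback:
  assumes f: "polynomial_function_Bil2 f" and uv: "area u v \<noteq> 0"
  shows "regular (\<lambda>T. f (act (frame u v) T))"
  using f
proof induction
  case (coord_fst i j k)
  show ?case unfolding act_frame[OF uv] unfolding frame_def by (intro regular_intros)
next
  case (coord_snd i j k)
  show ?case unfolding act_frame[OF uv] unfolding frame_def by (intro regular_intros)
qed (auto intro: regular_intros)

lemma zariski_closed_pullback:
  assumes "zariski_closed Z" and uv: "area u v \<noteq> 0"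
  shows "zariski_closed {T \<in> Bil2. act (frame u v) T \<in> Z}"
proof -
  obtain F where F: "\<And>f. f \<in> F \<Longrightarrow> polynomial_function_Bil2 f" "Z = zero_locus F"
    using assms(1) unfolding zariski_closed_def by blast
  have "{T \<in> Bil2. act (frame u v) T \<in> Z} =
      {T \<in> Bil2. \<forall>f. (if f \<in> F then f (act (frame u v) T) else 0) = 0}"
    using act_frame_in_Bil2[OF uv] by (auto simp: F zero_locus_def)
  also have "zariski_closed \<dots>"
  proof (intro zariski_closed_all zariski_closed_eq regular_const)
    show "regular (\<lambda>T. if f \<in> F then f (act (frame u v) T) else 0)" for f
      using regular_pullback[OF F(1) uv] by (cases "f \<in> F") (simp_all add: regular_const)
  qed
  finally show ?thesis .
qed

text \<open>Base change is continuous, so the closure of an invariant set is invariant. Hence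
  placing a normal form in a closure places its whole orbit there.\<close>

lemma orbit_in_closure:
  assumes "S \<subseteq> Bil2" and inv: "\<And>T R. T \<in> S \<Longrightarrow> R \<in> orbit T \<Longrightarrow> R \<in> S"
    and T: "T \<in> zariski closure_of S" "R \<in> orbit T"
  shows "R \<in> zariski closure_of S"
  unfolding mem_closure_zariski[OF assms(1)]
proof (intro allI impI; elim conjE)
  fix Z assume Z: "zariski_closed Z" "S \<subseteq> Z"
  obtain u v where uv: "area u v \<noteq> 0" "R = act (frame u v) T"
    using T(2) by (auto simp: orbit_frame)
  have "act (frame u v) Q \<in> S" if "Q \<in> S" for Q
    using inv[OF that] uv(1) unfolding orbit_frame by blast
  then have "S \<subseteq> {T \<in> Bil2. act (frame u v) T \<in> Z}" using Z(2) assms(1) by auto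
  then have "T \<in> {T \<in> Bil2. act (frame u v) T \<in> Z}"
    using T(1) zariski_closed_pullback[OF Z(1) uv(1)] unfolding mem_closure_zariski[OF assms(1)] by blast
  then show "R \<in> Z" by (simp add: uv)
qed

section \<open>Rational curves\<close>

definition polyfun :: "(complex \<Rightarrow> complex) \<Rightarrow> bool" where
  "polyfun h \<longleftrightarrow> (\<exists>p. h = poly p)"

definition polyfunV :: "(complex \<Rightarrow> V) \<Rightarrow> bool" where
  "polyfunV x \<longleftrightarrow> (\<forall>k. polyfun (\<lambda>z. x z $ k))"

named_theorems polyfun_intros

lemma polyfun_id [polyfun_intros]: "polyfun (\<lambda>z. z)"
  unfolding polyfun_def by (rule exI[of _ "[:0, 1:]"]) auto

lemma polyfun_const [polyfun_intros]: "polyfun (\<lambda>z. a)"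
  unfolding polyfun_def by (rule exI[of _ "[:a:]"]) auto

lemma polyfun_add [polyfun_intros]: "polyfun f \<Longrightarrow> polyfun g \<Longrightarrow> polyfun (\<lambda>z. f z + g z)"
  unfolding polyfun_def by (auto simp: fun_eq_iff intro: exI[of _ "_ + _"])

lemma polyfun_diff [polyfun_intros]: "polyfun f \<Longrightarrow> polyfun g \<Longrightarrow> polyfun (\<lambda>z. f z - g z)"
  unfolding polyfun_def by (auto simp: fun_eq_iff intro: exI[of _ "_ - _"])

lemma polyfun_mult [polyfun_intros]: "polyfun f \<Longrightarrow> polyfun g \<Longrightarrow> polyfun (\<lambda>z. f z * g z)"
  unfolding polyfun_def by (auto simp: fun_eq_iff intro: exI[of _ "_ * _"])

lemma polyfun_uminus [polyfun_intros]: "polyfun f \<Longrightarrow> polyfun (\<lambda>z. - f z)"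
  unfolding polyfun_def by (auto simp: fun_eq_iff intro: exI[of _ "- _"])

lemma polyfun_power [polyfun_intros]: "polyfun f \<Longrightarrow> polyfun (\<lambda>z. f z ^ n)"
  by (induction n) (auto intro: polyfun_intros)

lemma polyfunV_component [polyfun_intros]: "polyfunV x \<Longrightarrow> polyfun (\<lambda>z. x z $ k)"
  by (simp add: polyfunV_def)

lemma polyfunV_const [polyfun_intros]: "polyfunV (\<lambda>z. a)"
  by (simp add: polyfunV_def polyfun_intros)

lemma polyfunV_add [polyfun_intros]: "polyfunV x \<Longrightarrow> polyfunV y \<Longrightarrow> polyfunV (\<lambda>z. x z + y z)"
  by (simp add: polyfunV_def polyfun_intros)

lemma polyfunV_scale [polyfun_intros]: "polyfun f \<Longrightarrow> polyfunV x \<Longrightarrow> polyfunV (\<lambda>z. f z *s x z)"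
  by (simp add: polyfunV_def polyfun_intros)

lemma polyfun_area [polyfun_intros]: "polyfunV x \<Longrightarrow> polyfunV y \<Longrightarrow> polyfun (\<lambda>z. area (x z) (y z))"
  unfolding area_def by (intro polyfun_intros)

lemma polyfun_finite_zeros:
  assumes "polyfun f" "f a \<noteq> 0"
  shows "finite {z. f z = 0}"
proof -
  obtain p where p: "f = poly p" using assms(1) unfolding polyfun_def by blast
  then have "p \<noteq> 0" using assms(2) by auto
  then show ?thesis unfolding p by (rule poly_roots_finite)
qed

text \<open>One denominator \<open>D\<close> serves all structure constants, and nothing is asked at
  its zeros, where a moving frame degenerates and \<open>act\<close> no longer describes a change of
  basis.\<close>

definition rational_curve :: "(complex \<Rightarrow> complex) \<Rightarrow> (complex \<Rightarrow> product \<times> product) \<Rightarrow> bool" where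
  "rational_curve D \<gamma> \<longleftrightarrow> polyfun D \<and>
     (\<forall>i j k. \<exists>h. polyfun h \<and> (\<forall>z. D z \<noteq> 0 \<longrightarrow> fst (\<gamma> z) (axis i 1) (axis j 1) $ k = h z / D z)) \<and>
     (\<forall>i j k. \<exists>h. polyfun h \<and> (\<forall>z. D z \<noteq> 0 \<longrightarrow> snd (\<gamma> z) (axis i 1) (axis j 1) $ k = h z / D z))"

lemma polynomial_along_curve:
  assumes "polynomial_function_Bil2 f" and \<gamma>: "rational_curve D \<gamma>"
  shows "\<exists>h n. polyfun h \<and> (\<forall>z. D z \<noteq> 0 \<longrightarrow> f (\<gamma> z) = h z / D z ^ n)"
  using assms(1)
proof induction
  case (const a)
  show ?case by (intro exI[of _ "\<lambda>z. a"] exI[of _ 0]) (auto intro: polyfun_intros)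
next
  case (coord_fst i j k)
  obtain h where "polyfun h" "\<forall>z. D z \<noteq> 0 \<longrightarrow> fst (\<gamma> z) (axis i 1) (axis j 1) $ k = h z / D z"
    using \<gamma> unfolding rational_curve_def by blast
  then show ?case by (intro exI[of _ h] exI[of _ 1]) auto
next
  case (coord_snd i j k)
  obtain h where "polyfun h" "\<forall>z. D z \<noteq> 0 \<longrightarrow> snd (\<gamma> z) (axis i 1) (axis j 1) $ k = h z / D z"
    using \<gamma> unfolding rational_curve_def by blast
  then show ?case by (intro exI[of _ h] exI[of _ 1]) auto
next
  case (add f g)
  obtain h n where h: "polyfun h" "\<And>z. D z \<noteq> 0 \<Longrightarrow> f (\<gamma> z) = h z / D z ^ n" using add by auto
  obtain h' n' where h': "polyfun h'" "\<And>z. D z \<noteq> 0 \<Longrightarrow> g (\<gamma> z) = h' z / D z ^ n'" using add by auto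
  have "polyfun D" using \<gamma> by (simp add: rational_curve_def)
  then show ?case
    by (intro exI[of _ "\<lambda>z. h z * D z ^ n' + h' z * D z ^ n"] exI[of _ "n + n'"])
      (auto simp: h h' field_simps power_add intro!: polyfun_intros)
next
  case (mult f g)
  obtain h n where h: "polyfun h" "\<And>z. D z \<noteq> 0 \<Longrightarrow> f (\<gamma> z) = h z / D z ^ n" using mult by auto
  obtain h' n' where h': "polyfun h'" "\<And>z. D z \<noteq> 0 \<Longrightarrow> g (\<gamma> z) = h' z / D z ^ n'" using mult by auto
  show ?case
    by (intro exI[of _ "\<lambda>z. h z * h' z"] exI[of _ "n + n'"])
      (auto simp: h h' field_simps power_add intro!: polyfun_intros)
qed

lemma zariski_closed_separate:
  assumes "zariski_closed Z" "T \<in> Bil2" "T \<notin> Z"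
  obtains f where "polynomial_function_Bil2 f" "f T \<noteq> 0" "\<And>S. S \<in> Z \<Longrightarrow> f S = 0"
proof -
  obtain F where F: "\<forall>f\<in>F. polynomial_function_Bil2 f" "Z = zero_locus F"
    using assms(1) unfolding zariski_closed_def by (elim exE conjE)
  then obtain f where "f \<in> F" "f T \<noteq> 0" using assms(2,3) by (auto simp: zero_locus_def)
  then show ?thesis using that[of f] F by (simp add: zero_locus_def)
qed

text \<open>Two points on a common rational curve in \<open>S\<close> cannot be separated by two closed sets covering
  \<open>S\<close>, because a product of two one-variable polynomials vanishes only if one of them does.\<close>

lemma irreducible_by_curves:
  assumes S: "S \<subseteq> Bil2" "S \<noteq> {}"
    and curves: "\<And>s t. s \<in> S \<Longrightarrow> t \<in> S \<Longrightarrow> \<exists>D \<gamma>. rational_curve D \<gamma> \<and> D 0 \<noteq> 0 \<and> D 1 \<noteq> 0 \<and>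
      \<gamma> 0 = s \<and> \<gamma> 1 = t \<and> (\<forall>z. D z \<noteq> 0 \<longrightarrow> \<gamma> z \<in> S)"
  shows "irreducible_in zariski S"
proof -
  have "S \<subseteq> A \<or> S \<subseteq> B" if AB: "zariski_closed A" "zariski_closed B" "S \<subseteq> A \<union> B" for A B
  proof (rule ccontr)
    assume "\<not> (S \<subseteq> A \<or> S \<subseteq> B)"
    then obtain s t where st: "s \<in> S" "s \<notin> A" "t \<in> S" "t \<notin> B" by blast
    obtain f where f: "polynomial_function_Bil2 f" "f s \<noteq> 0" "\<And>T. T \<in> A \<Longrightarrow> f T = 0"
      by (rule zariski_closed_separate[OF AB(1) subsetD[OF S(1) st(1)] st(2)]) (rule that)
    obtain g where g: "polynomial_function_Bil2 g" "g t \<noteq> 0" "\<And>T. T \<in> B \<Longrightarrow> g T = 0"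
      by (rule zariski_closed_separate[OF AB(2) subsetD[OF S(1) st(3)] st(4)]) (rule that)
    obtain D \<gamma> where \<gamma>: "rational_curve D \<gamma>" "D 0 \<noteq> 0" "D 1 \<noteq> 0" "\<gamma> 0 = s" "\<gamma> 1 = t"
      "\<And>z. D z \<noteq> 0 \<Longrightarrow> \<gamma> z \<in> S"
      using curves[OF st(1,3)] by (elim exE conjE) (rule that, assumption+, iprover)
    obtain p m where p: "polyfun p" "\<And>z. D z \<noteq> 0 \<Longrightarrow> f (\<gamma> z) = p z / D z ^ m"
      using polynomial_along_curve[OF f(1) \<gamma>(1)] by blast
    obtain q n where q: "polyfun q" "\<And>z. D z \<noteq> 0 \<Longrightarrow> g (\<gamma> z) = q z / D z ^ n"
      using polynomial_along_curve[OF g(1) \<gamma>(1)] by blast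
    have pq: "p 0 \<noteq> 0" "q 1 \<noteq> 0"
      using p(2)[OF \<gamma>(2)] q(2)[OF \<gamma>(3)] \<gamma>(4,5) f(2) g(2) by simp_all
    have D: "polyfun D" using \<gamma>(1) by (simp add: rational_curve_def)
    have "finite ({z. p z = 0} \<union> {z. q z = 0} \<union> {z. D z = 0})"
      by (intro finite_UnI polyfun_finite_zeros[OF p(1) pq(1)] polyfun_finite_zeros[OF q(1) pq(2)]
          polyfun_finite_zeros[OF D \<gamma>(2)])
    from ex_new_if_finite[OF infinite_UNIV_char_0 this]
    obtain z where z: "p z \<noteq> 0" "q z \<noteq> 0" "D z \<noteq> 0" by auto
    then have "f (\<gamma> z) \<noteq> 0" "g (\<gamma> z) \<noteq> 0" using p(2)[OF z(3)] q(2)[OF z(3)] by simp_all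
    then have "\<gamma> z \<notin> A" "\<gamma> z \<notin> B" using f(3) g(3) by (metis, metis)
    then show False using subsetD[OF AB(3) \<gamma>(6)[OF z(3)]] by simp
  qed
  then show ?thesis
    using S by (auto simp: irreducible_in_def topspace_zariski closedin_zariski)
qed

text \<open>A polynomial vanishing on \<open>S\<close> vanishes along the curve for all but finitely
  many parameters, hence identically, hence also at the limit \<open>\<gamma> 0\<close>.\<close>

lemma curve_in_closure:
  assumes "S \<subseteq> Bil2" "rational_curve (\<lambda>z. 1) \<gamma>" "finite {z. \<gamma> z \<notin> S}" "\<gamma> 0 \<in> Bil2"
  shows "\<gamma> 0 \<in> zariski closure_of S"
  unfolding mem_closure_zariski[OF assms(1)]
proof (intro allI impI; elim conjE)
  fix Z assume Z: "zariski_closed Z" "S \<subseteq> Z"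
  show "\<gamma> 0 \<in> Z"
  proof (rule ccontr)
    assume "\<gamma> 0 \<notin> Z"
    obtain f where f: "polynomial_function_Bil2 f" "f (\<gamma> 0) \<noteq> 0" "\<And>T. T \<in> Z \<Longrightarrow> f T = 0"
      by (rule zariski_closed_separate[OF Z(1) assms(4) \<open>\<gamma> 0 \<notin> Z\<close>]) (rule that)
    obtain p where p: "polyfun p" "\<And>z. f (\<gamma> z) = p z"
      using polynomial_along_curve[OF f(1) assms(2)] by auto
    have "p 0 \<noteq> 0" using f(2) p(2)[of 0] by simp
    then have "finite ({z. p z = 0} \<union> {z. \<gamma> z \<notin> S})"
      by (intro finite_UnI polyfun_finite_zeros[OF p(1)] assms(3))
    from ex_new_if_finite[OF infinite_UNIV_char_0 this]
    obtain z where "p z \<noteq> 0" "\<gamma> z \<in> S" by auto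
    then show False using f(3)[OF subsetD[OF Z(2), of "\<gamma> z"]] p(2)[of z] by simp
  qed
qed

lemma rational_curve_mult_table:
  assumes "polyfunV a" "polyfunV b" "polyfunV c" "polyfunV d"
    "polyfunV a'" "polyfunV b'" "polyfunV c'" "polyfunV d'"
  shows "rational_curve (\<lambda>z. 1) (\<lambda>z. (mult_table (a z) (b z) (c z) (d z), mult_table (a' z) (b' z) (c' z) (d' z)))"
proof -
  have *: "polyfun (\<lambda>z. mult_table (a z) (b z) (c z) (d z) x y $ k)"
    "polyfun (\<lambda>z. mult_table (a' z) (b' z) (c' z) (d' z) x y $ k)" for x y k
    unfolding mult_table_def by (intro polyfun_intros assms)+
  show ?thesis
    unfolding rational_curve_def fst_conv snd_conv
  proof (intro conjI allI polyfun_const)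
    fix i j k
    show "\<exists>h. polyfun h \<and> (\<forall>z. 1 \<noteq> (0::complex) \<longrightarrow>
        mult_table (a z) (b z) (c z) (d z) (axis i 1) (axis j 1) $ k = h z / 1)"
      by (rule exI, rule conjI, rule *(1)[of "axis i 1" "axis j 1" k]) simp
    show "\<exists>h. polyfun h \<and> (\<forall>z. 1 \<noteq> (0::complex) \<longrightarrow>
        mult_table (a' z) (b' z) (c' z) (d' z) (axis i 1) (axis j 1) $ k = h z / 1)"
      by (rule exI, rule conjI, rule *(2)[of "axis i 1" "axis j 1" k]) simp
  qed
qed

lemma rational_curve_act:
  assumes uv: "polyfunV u" "polyfunV v"
    and P: "\<And>z. P z = (mult_table (a z) (b z) (c z) (d z), mult_table (a' z) (b' z) (c' z) (d' z))"
    and coords: "polyfunV a" "polyfunV b" "polyfunV c" "polyfunV d"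
      "polyfunV a'" "polyfunV b'" "polyfunV c'" "polyfunV d'"
  shows "rational_curve (\<lambda>z. area (u z) (v z) ^ 2) (\<lambda>z. act (frame (u z) (v z)) (P z))"
proof -
  \<comment> \<open>The numerator of \<open>coframe\<close>, which is polynomial in
    \<open>z\<close>. A product takes two arguments, hence the square of the area in the
    denominator.\<close>
  define w where "w x z = area x (v z) *s e1 + area (u z) x *s e2" for x z
  have w: "polyfunV (w x)" for x
    unfolding w_def by (intro polyfun_intros uv)
  have coframe: "coframe (u z) (v z) x = (1 / area (u z) (v z)) *s w x z" for x z
    by (simp add: coframe_def w_def vec2_eq_iff)
  have *: "frame (u z) (v z) (mult_table p q r s (coframe (u z) (v z) x) (coframe (u z) (v z) y)) $ k =
      frame (u z) (v z) (mult_table p q r s (w x z) (w y z)) $ k / area (u z) (v z) ^ 2" for p q r s x y z k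
    unfolding coframe cbilinearD[OF cbilinear_mult_table] clinear2D[OF clinear2_frame]
    by (simp add: power2_eq_square)
  have **: "\<exists>h. polyfun h \<and> (\<forall>z. area (u z) (v z) ^ 2 \<noteq> 0 \<longrightarrow>
      frame (u z) (v z) (mult_table (p z) (q z) (r z) (s z) (coframe (u z) (v z) x) (coframe (u z) (v z) y)) $ k
        = h z / area (u z) (v z) ^ 2)"
    if "polyfunV p" "polyfunV q" "polyfunV r" "polyfunV s" for p q r s x y k
  proof (intro exI conjI allI impI)
    show "polyfun (\<lambda>z. frame (u z) (v z) (mult_table (p z) (q z) (r z) (s z) (w x z) (w y z)) $ k)"
      unfolding frame_def mult_table_def by (intro polyfun_intros that uv w)
  qed (rule *)
  have "polyfun (\<lambda>z. area (u z) (v z) ^ 2)" by (intro polyfun_intros uv)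
  then show ?thesis
    unfolding rational_curve_def using **[OF coords(1-4)] **[OF coords(5-8)]
    by (simp add: act_frame P)
qed

lemma irreducible_orbit_family:
  assumes P: "\<And>\<alpha>. P \<alpha> = (mult_table (a \<alpha>) (b \<alpha>) (c \<alpha>) (d \<alpha>), mult_table (a' \<alpha>) (b' \<alpha>) (c' \<alpha>) (d' \<alpha>))"
    and coords: "\<And>f. polyfun f \<Longrightarrow> polyfunV (\<lambda>z. a (f z))" "\<And>f. polyfun f \<Longrightarrow> polyfunV (\<lambda>z. b (f z))"
      "\<And>f. polyfun f \<Longrightarrow> polyfunV (\<lambda>z. c (f z))" "\<And>f. polyfun f \<Longrightarrow> polyfunV (\<lambda>z. d (f z))"
      "\<And>f. polyfun f \<Longrightarrow> polyfunV (\<lambda>z. a' (f z))" "\<And>f. polyfun f \<Longrightarrow> polyfunV (\<lambda>z. b' (f z))"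
      "\<And>f. polyfun f \<Longrightarrow> polyfunV (\<lambda>z. c' (f z))" "\<And>f. polyfun f \<Longrightarrow> polyfunV (\<lambda>z. d' (f z))"
  shows "irreducible_in zariski (\<Union>\<alpha>. orbit (P \<alpha>))"
proof (rule irreducible_by_curves)
  show "(\<Union>\<alpha>. orbit (P \<alpha>)) \<subseteq> Bil2" by (intro UN_least orbit_in_Bil2) (simp add: P)
  have "area e1 e2 \<noteq> 0" by (simp add: area_def)
  then have "act (frame e1 e2) (P 0) \<in> orbit (P 0)" unfolding orbit_frame by blast
  then show "(\<Union>\<alpha>. orbit (P \<alpha>)) \<noteq> {}" by blast
next
  fix s t assume "s \<in> (\<Union>\<alpha>. orbit (P \<alpha>))" "t \<in> (\<Union>\<alpha>. orbit (P \<alpha>))"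
  then obtain \<alpha> u v \<beta> u' v' where
    s: "area u v \<noteq> 0" "s = act (frame u v) (P \<alpha>)" and t: "area u' v' \<noteq> 0" "t = act (frame u' v') (P \<beta>)"
    by (auto simp: orbit_frame)
  \<comment> \<open>Frames and parameters are joined by straight lines in their affine spaces; the
    line leaves the invertible frames only at zeros of the area. Moving the parameter too connects
    different orbits of the family.\<close>
  define U where "U z = (1 - z) *s u + z *s u'" for z
  define W where "W z = (1 - z) *s v + z *s v'" for z
  define f where "f z = (1 - z) * \<alpha> + z * \<beta>" for z
  have pf: "polyfunV U" "polyfunV W" "polyfun f"
    unfolding U_def W_def f_def by (intro polyfun_intros)+
  have "rational_curve (\<lambda>z. area (U z) (W z) ^ 2) (\<lambda>z. act (frame (U z) (W z)) (P (f z)))"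
    by (rule rational_curve_act[OF pf(1,2) P]) (intro coords pf)+
  moreover have "U 0 = u" "U 1 = u'" "W 0 = v" "W 1 = v'" "f 0 = \<alpha>" "f 1 = \<beta>"
    by (simp_all add: U_def W_def f_def vec2_eq_iff)
  ultimately show "\<exists>D \<gamma>. rational_curve D \<gamma> \<and> D 0 \<noteq> 0 \<and> D 1 \<noteq> 0 \<and> \<gamma> 0 = s \<and> \<gamma> 1 = t \<and>
      (\<forall>z. D z \<noteq> 0 \<longrightarrow> \<gamma> z \<in> (\<Union>\<alpha>. orbit (P \<alpha>)))"
    using s t
  proof (intro exI conjI)
    show "\<forall>z. (area (U z) (W z))\<^sup>2 \<noteq> 0 \<longrightarrow> act (frame (U z) (W z)) (P (f z)) \<in> (\<Union>\<alpha>. orbit (P \<alpha>))"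
      unfolding orbit_frame by simp blast
  qed simp_all
qed

lemma irreducible_orbit:
  assumes "P \<in> Bil2"
  shows "irreducible_in zariski (orbit P)"
proof -
  obtain a b c d a' b' c' d' where "P = (mult_table a b c d, mult_table a' b' c' d')"
    using Bil2_cases[OF assms] by blast
  then show ?thesis
    using irreducible_orbit_family[of "\<lambda>_. P" "\<lambda>_. a" "\<lambda>_. b" "\<lambda>_. c" "\<lambda>_. d" "\<lambda>_. a'" "\<lambda>_. b'" "\<lambda>_. c'" "\<lambda>_. d'"]
    by (simp add: polyfun_intros)
qed

section \<open>Irreducible components of a topological space\<close>

lemma irreducible_in_closure_of:
  assumes "irreducible_in X S"
  shows "irreducible_in X (X closure_of S)"
proof -
  have S: "S \<subseteq> topspace X" "S \<noteq> {}"
    and irr: "\<And>A B. closedin X A \<Longrightarrow> closedin X B \<Longrightarrow> S \<subseteq> A \<union> B \<Longrightarrow> S \<subseteq> A \<or> S \<subseteq> B"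
    using assms by (simp_all add: irreducible_in_def)
  show ?thesis
    unfolding irreducible_in_def
  proof (intro conjI allI impI; (elim conjE)?)
    show "X closure_of S \<noteq> {}" using S closure_of_subset[OF S(1)] by blast
  next
    fix A B assume AB: "closedin X A" "closedin X B" "X closure_of S \<subseteq> A \<union> B"
    then have "S \<subseteq> A \<or> S \<subseteq> B" using irr closure_of_subset[OF S(1)] by (meson order_trans)
    then show "X closure_of S \<subseteq> A \<or> X closure_of S \<subseteq> B"
      using AB closure_of_minimal by metis
  qed (rule closure_of_subset_topspace)
qed

text \<open>Lets irreducibility be treated in the ambient space \<open>Bil2\<close>, where the
  curves live.\<close>

lemma irreducible_in_closed_subtopology:
  assumes "closedin X C"
  shows "irreducible_in (subtopology X C) S \<longleftrightarrow> irreducible_in X S \<and> S \<subseteq> C"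
proof -
  have C: "topspace (subtopology X C) = C" using assms closedin_subset[OF assms] by auto
  show ?thesis
    unfolding irreducible_in_def C closedin_closed_subtopology[OF assms]
  proof (intro iffI conjI allI impI; elim conjE)
    fix A B
    assume irr: "\<forall>A B. (closedin X A \<and> A \<subseteq> C) \<and> (closedin X B \<and> B \<subseteq> C) \<and> S \<subseteq> A \<union> B \<longrightarrow> S \<subseteq> A \<or> S \<subseteq> B"
      and "S \<subseteq> C" "S \<subseteq> A \<union> B" "closedin X A" "closedin X B"
    then have "S \<subseteq> A \<inter> C \<or> S \<subseteq> B \<inter> C"
      by (intro irr[rule_format]) (auto intro: closedin_Int assms)
    then show "S \<subseteq> A \<or> S \<subseteq> B" by (simp only: le_inf_iff) (elim disjE conjE; simp)
  next
    assume "S \<subseteq> C"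
    then show "S \<subseteq> topspace X" using closedin_subset[OF assms] by (rule order_trans)
  qed (assumption | simp)+
qed

lemma irreducible_subset_Union:
  assumes "irreducible_in X S" "finite \<C>" "\<And>C. C \<in> \<C> \<Longrightarrow> closedin X C" "S \<subseteq> \<Union>\<C>"
  shows "\<exists>C\<in>\<C>. S \<subseteq> C"
  using assms(2-)
proof (induction \<C>)
  case empty
  then show ?case using assms(1) by (auto simp: irreducible_in_def)
next
  case (insert C \<C>)
  have "closedin X (\<Union>\<C>)" using insert by (intro closedin_Union) auto
  then have "S \<subseteq> C \<or> S \<subseteq> \<Union>\<C>"
    using assms(1) insert.prems unfolding irreducible_in_def by simp
  then show ?case using insert by auto
qed

text \<open>An irreducible set inside a finite closed cover lies in one member, so maximal
  irreducible sets are members; incomparability makes every member maximal.\<close>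

lemma irreducible_components_eqI:
  assumes fin: "finite \<C>" and irr: "\<And>C. C \<in> \<C> \<Longrightarrow> irreducible_in X C"
    and closed: "\<And>C. C \<in> \<C> \<Longrightarrow> closedin X C" and cover: "topspace X \<subseteq> \<Union>\<C>"
    and incomparable: "\<And>C C'. C \<in> \<C> \<Longrightarrow> C' \<in> \<C> \<Longrightarrow> C \<subseteq> C' \<Longrightarrow> C = C'"
  shows "irreducible_components X = \<C>"
proof -
  have *: "\<exists>C\<in>\<C>. S \<subseteq> C" if "irreducible_in X S" for S
    using that cover by (intro irreducible_subset_Union[OF that fin closed]) (auto simp: irreducible_in_def)
  show ?thesis
  proof (intro set_eqI iffI)
    fix S assume "S \<in> irreducible_components X"
    then have S: "irreducible_in X S" "\<And>S'. irreducible_in X S' \<Longrightarrow> S \<subseteq> S' \<Longrightarrow> S' = S"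
      unfolding irreducible_components_def by blast+
    obtain C where "C \<in> \<C>" "S \<subseteq> C" using *[OF S(1)] by blast
    then show "S \<in> \<C>" using S(2)[OF irr] by blast
  next
    fix C assume C: "C \<in> \<C>"
    have "S = C" if S: "irreducible_in X S" "C \<subseteq> S" for S
    proof -
      obtain C' where "C' \<in> \<C>" "S \<subseteq> C'" using *[OF S(1)] by blast
      then show ?thesis using incomparable[OF C, of C'] S(2) by blast
    qed
    then show "C \<in> irreducible_components X"
      using irr[OF C] unfolding irreducible_components_def by blast
  qed
qed

section \<open>Invariant closed sets\<close>

lemma act_frame_frame:
  assumes "area u v \<noteq> 0"
  shows "fst (act (frame u v) T) (frame u v x) (frame u v y) = frame u v (fst T x y)"
    "snd (act (frame u v) T) (frame u v x) (frame u v y) = frame u v (snd T x y)"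
  by (simp_all add: act_frame coframe_frame assms)

text \<open>A frame is bijective, so every triple of vectors is the frame image of its coframe
  coordinates, and only pointwise equivariance of the condition remains.\<close>

lemma orbit_invariant:
  assumes T: "T \<in> {T \<in> Bil2. \<forall>x y z. \<Phi> T x y z}" and S: "S \<in> orbit T"
    and inv: "\<And>u v x y z. area u v \<noteq> 0 \<Longrightarrow> \<Phi> T x y z \<Longrightarrow>
      \<Phi> (act (frame u v) T) (frame u v x) (frame u v y) (frame u v z)"
  shows "S \<in> {T \<in> Bil2. \<forall>x y z. \<Phi> T x y z}"
proof -
  obtain u v where uv: "area u v \<noteq> 0" "S = act (frame u v) T" using S by (auto simp: orbit_frame)
  have "\<Phi> S x y z" for x y z
    using inv[OF uv(1), of "coframe u v x" "coframe u v y" "coframe u v z"] T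
    by (simp add: frame_coframe uv)
  then show ?thesis using act_frame_in_Bil2[OF uv(1), of T] T unfolding uv(2) by blast
qed

definition commutative_locus :: "(product \<times> product) set" where
  "commutative_locus = {T \<in> Bil2. \<forall>x y z::V. snd T x y = snd T y x}"

text \<open>With \<open>L\<^sub>x\<close> and \<open>R\<^sub>x\<close> the left and right multiplications of the pre-Lie product, the next three
  loci say \<open>det R\<^sub>x = 0\<close>, \<open>(tr R\<^sub>x)\<^sup>2 = 4 det R\<^sub>x\<close> and \<open>2 tr L\<^sub>x = 3 tr R\<^sub>x\<close>; determinant and trace
  are expressed through \<open>area\<close>, which makes the invariance under base change evident.\<close>

definition singular_locus :: "(product \<times> product) set" where
  "singular_locus = {T \<in> Bil2. \<forall>x y z. area (snd T y x) (snd T z x) = 0}"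

definition discriminant_locus :: "(product \<times> product) set" where
  "discriminant_locus = {T \<in> Bil2. \<forall>x y z.
     (area (snd T y x) z + area y (snd T z x))\<^sup>2 = 4 * area (snd T y x) (snd T z x) * area y z}"

definition trace_locus :: "(product \<times> product) set" where
  "trace_locus = {T \<in> Bil2. \<forall>x y z.
     2 * (area (snd T x y) z + area y (snd T x z)) = 3 * (area (snd T y x) z + area y (snd T z x))}"

text \<open>In \<open>zinbiel_form a b\<close> the dot product of \<open>e1\<close> with the circle
  square of \<open>e1\<close> is \<open>a *s e2\<close>. This condition is weaker than a vanishing
  dot product: it also holds for \<open>zinbiel_form 0 b\<close>, so that its complement in the
  variety is exactly the orbit of \<open>P10\<close>.\<close>

definition annihilator_locus :: "(product \<times> product) set" where
  "annihilator_locus = {T \<in> Bil2. \<forall>x y z. fst T x (snd T y z) = 0}"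

lemmas locus_defs = commutative_locus_def singular_locus_def discriminant_locus_def
  trace_locus_def annihilator_locus_def

lemma locus_closed:
  "zariski_closed commutative_locus" "zariski_closed singular_locus"
  "zariski_closed discriminant_locus" "zariski_closed trace_locus" "zariski_closed annihilator_locus"
  unfolding locus_defs
  by (intro zariski_closed_all zariski_closed_eq zariski_closed_eqV regular_intros)+

lemma commutative_locus_orbit:
  "T \<in> commutative_locus \<Longrightarrow> S \<in> orbit T \<Longrightarrow> S \<in> commutative_locus"
  unfolding commutative_locus_def by (erule (1) orbit_invariant) (simp add: act_frame_frame)

lemma singular_locus_orbit: "T \<in> singular_locus \<Longrightarrow> S \<in> orbit T \<Longrightarrow> S \<in> singular_locus"
  unfolding singular_locus_def by (erule (1) orbit_invariant) (simp add: act_frame_frame area_frame)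

lemma discriminant_locus_orbit:
  "T \<in> discriminant_locus \<Longrightarrow> S \<in> orbit T \<Longrightarrow> S \<in> discriminant_locus"
  unfolding discriminant_locus_def
  by (erule (1) orbit_invariant)
    (simp add: act_frame_frame area_frame power_mult_distrib power2_eq_square flip: distrib_left)

lemma trace_locus_orbit: "T \<in> trace_locus \<Longrightarrow> S \<in> orbit T \<Longrightarrow> S \<in> trace_locus"
  unfolding trace_locus_def
proof (erule (1) orbit_invariant)
  fix u v x y z
  let ?L = "area (snd T x y) z + area y (snd T x z)"
  let ?R = "area (snd T y x) z + area y (snd T z x)"
  assume "area u v \<noteq> 0" "2 * ?L = 3 * ?R"
  then have "area u v * (2 * ?L) = area u v * (3 * ?R)" by simp
  then show "2 * (area (snd (act (frame u v) T) (frame u v x) (frame u v y)) (frame u v z) +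
      area (frame u v y) (snd (act (frame u v) T) (frame u v x) (frame u v z))) =
    3 * (area (snd (act (frame u v) T) (frame u v y) (frame u v x)) (frame u v z) +
      area (frame u v y) (snd (act (frame u v) T) (frame u v z) (frame u v x)))"
    by (simp only: act_frame_frame[OF \<open>area u v \<noteq> 0\<close>] area_frame distrib_left mult.left_commute)
qed

lemma annihilator_locus_orbit:
  "T \<in> annihilator_locus \<Longrightarrow> S \<in> orbit T \<Longrightarrow> S \<in> annihilator_locus"
  unfolding annihilator_locus_def
  by (erule (1) orbit_invariant) (simp add: act_frame_frame clinear2D)

lemma variety_eq:
  "pre_poisson_variety = {T \<in> Bil2. \<forall>x y z.
     fst T x (fst T y z) = fst T (fst T y x + fst T x y) z \<and>
     snd T (snd T x y) z - snd T (snd T y x) z = snd T x (snd T y z) - snd T y (snd T x z) \<and>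
     fst T (snd T x y - snd T y x) z = snd T x (fst T y z) - fst T y (snd T x z) \<and>
     snd T (fst T x y + fst T y x) z = fst T x (snd T y z) + fst T y (snd T x z)}"
  unfolding pre_poisson_variety_eq all_conj_distrib ..

lemma variety_orbit:
  "T \<in> pre_poisson_variety \<Longrightarrow> S \<in> orbit T \<Longrightarrow> S \<in> pre_poisson_variety"
  unfolding variety_eq
  by (erule (1) orbit_invariant)
    (simp add: act_frame_frame flip: clinear2D(1)[OF clinear2_frame] clinear2D(4)[OF clinear2_frame])

lemma variety_subset: "pre_poisson_variety \<subseteq> Bil2"
  unfolding pre_poisson_variety_def by blast

lemma orbit_refl:
  assumes "T \<in> Bil2"
  shows "T \<in> orbit T"
  using assms by (intro orbitI[of _ _ e1 e2]) (simp_all add: area_def frame_def flip: V_expand)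

text \<open>\<open>T'\<close> is \<open>T\<close> written in the basis \<open>u\<close>,
  \<open>v\<close>; the two equations make \<open>frame u v\<close> an isomorphism from
  \<open>T'\<close> to \<open>T\<close>.\<close>

lemma change_frame:
  assumes T: "T \<in> pre_poisson_variety" and uv: "area u v \<noteq> 0"
  obtains T' where "T' \<in> pre_poisson_variety" "T \<in> orbit T'"
    "\<And>x y. fst T (frame u v x) (frame u v y) = frame u v (fst T' x y)"
    "\<And>x y. snd T (frame u v x) (frame u v y) = frame u v (snd T' x y)"
proof -
  have "act (frame u v) T \<in> orbit T" using uv unfolding orbit_frame by blast
  define T' where "T' = act (inv (frame u v)) T"
  have bij: "bij (inv (frame u v))" "clinear2 (inv (frame u v))"
    using bij_imp_bij_inv[OF bij_frame[OF uv]] coframe_eq_frame[of u v]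
    by (simp_all add: inv_frame[OF uv]) (metis clinear2_frame)
  then have T': "T' \<in> orbit T" unfolding orbit_def T'_def by blast
  have eq: "T = act (frame u v) T'"
    using bij_frame[OF uv] by (simp add: T'_def act_def split_beta inv_inv_eq bij_is_surj surj_f_inv_f bij_is_inj)
  show ?thesis
    using that[of T'] variety_orbit[OF T T'] orbit_sym[OF T'] act_frame_frame[OF uv, of T']
    by (simp flip: eq)
qed

section \<open>Normal forms\<close>

definition zinbiel_form :: "complex \<Rightarrow> complex \<Rightarrow> product \<times> product" where
  "zinbiel_form a b = (mult_table e2 0 0 0, mult_table (a *s e1 + b *s e2) (a *s e2) (a *s e2) 0)"

text \<open>The ideal \<open>(X)\<close> of \<open>\<complex>[X]/(X(X - r)(X - s))\<close> with basis \<open>X, X\<^sup>2\<close>.\<close>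

definition cyclic_form :: "complex \<Rightarrow> complex \<Rightarrow> product \<times> product" where
  "cyclic_form r s = (mult_table 0 0 0 0,
     mult_table e2 (- (r * s) *s e1 + (r + s) *s e2) (- (r * s) *s e1 + (r + s) *s e2)
       (- (r * s * (r + s)) *s e1 + ((r + s)\<^sup>2 - r * s) *s e2))"

text \<open>This and the next two tables solve the pre-Lie equations under
  \<open>[e1, e2] = e2\<close>, once the first component of the product of \<open>e1\<close> with
  \<open>e2\<close> has been removed by a change of frame.\<close>

definition left_form :: "complex \<Rightarrow> complex \<Rightarrow> product \<times> product" where
  "left_form a b = (mult_table 0 0 0 0, mult_table (a *s e1 + b *s e2) e2 0 0)"

definition unital_form :: "complex \<Rightarrow> complex \<Rightarrow> product \<times> product" where
  "unital_form a b = (mult_table 0 0 0 0, mult_table (a *s e1 + b *s e2) ((a + 1) *s e2) (a *s e2) 0)"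

text \<open>Rescaling \<open>e2\<close> multiplies \<open>d\<close> by a square, so all
  \<open>d \<noteq> 0\<close> give a single orbit, that of \<open>P08\<close>.\<close>

definition simple_form :: "complex \<Rightarrow> product \<times> product" where
  "simple_form d = (mult_table 0 0 0 0, mult_table (2 *s e1) e2 0 (d *s e1))"

lemmas form_defs = zinbiel_form_def cyclic_form_def left_form_def unital_form_def simple_form_def
lemmas P_defs = P05_def P06_def P07_def P08_def P10_def

lemma form_in_Bil2 [simp]:
  "zinbiel_form a b \<in> Bil2" "cyclic_form r s \<in> Bil2" "left_form a b \<in> Bil2" "unital_form a b \<in> Bil2"
  "simple_form d \<in> Bil2" "P05 \<alpha> \<in> Bil2" "P06 \<alpha> \<in> Bil2" "P07 \<in> Bil2" "P08 \<in> Bil2" "P10 \<in> Bil2"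
  by (simp_all add: form_defs P_defs)

section \<open>Explicit isomorphisms of normal forms with the listed structures\<close>

text \<open>By \<open>orbit_sym\<close> the two vectors may be sought in the simpler table of
  \<open>P10\<close>. The second is the dot square of the first, and the component
  \<open>a * b\<close> produces \<open>b\<close> in the circle square.\<close>

lemma P10_orbit_zinbiel_form:
  assumes "a \<noteq> 0"
  shows "zinbiel_form a b \<in> orbit P10"
proof (rule orbit_sym, rule orbitI[OF form_in_Bil2(10) form_in_Bil2(1)])
  show "area (a *s e1 + (a * b) *s e2) (a\<^sup>2 *s e2) \<noteq> 0" using assms by (simp add: area_def)
qed (simp_all add: zinbiel_form_def P10_def mult_table_def frame_def vec2_eq_iff power2_eq_square algebra_simps)

text \<open>\<open>P07\<close> is the product of two copies of the field. Evaluation at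
  \<open>r\<close> and \<open>s\<close> sends \<open>X\<close> to \<open>(r, s)\<close> and its
  square to \<open>(r * r, s * s)\<close>; by a Vandermonde determinant these form a basis when 0,
  \<open>r\<close>, \<open>s\<close> are distinct.\<close>

lemma P07_orbit_cyclic_form:
  assumes "r \<noteq> 0" "s \<noteq> 0" "r \<noteq> s"
  shows "cyclic_form r s \<in> orbit P07"
proof (rule orbit_sym, rule orbitI[OF form_in_Bil2(8) form_in_Bil2(2)])
  have "area (r *s e1 + s *s e2) (r\<^sup>2 *s e1 + s\<^sup>2 *s e2) = r * s * (s - r)"
    by (simp add: area_def power2_eq_square algebra_simps)
  then show "area (r *s e1 + s *s e2) (r\<^sup>2 *s e1 + s\<^sup>2 *s e2) \<noteq> 0" using assms by simp
qed (simp_all add: cyclic_form_def P07_def mult_table_def frame_def vec2_eq_iff power2_eq_square algebra_simps)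

text \<open>Normalising the bracket to \<open>e2\<close> scales the idempotent by \<open>a\<close>,
  so the parameter becomes \<open>1 / a\<close>. Adding \<open>t *s e2\<close> to \<open>e1\<close>
  changes \<open>b\<close> by \<open>t * (1 - a)\<close>, which can remove \<open>b\<close> unless
  \<open>a = 1\<close>.\<close>

lemma P05_orbit_left_form:
  assumes "a \<noteq> 0" "a \<noteq> 1"
  shows "left_form a b \<in> orbit (P05 (1 / a))"
proof (rule orbit_sym, rule orbitI[OF form_in_Bil2(6) form_in_Bil2(3)])
  show "area (a *s e1 + (b / (1 - a)) *s e2) e2 \<noteq> 0" using assms by (simp add: area_def)
qed (use assms in \<open>simp_all add: left_form_def P05_def mult_table_def frame_def vec2_eq_iff divide_simps\<close>,
     simp_all add: algebra_simps)

text \<open>Here adding \<open>t *s e2\<close> to \<open>e1\<close> changes \<open>b\<close> by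
  \<open>t * (a + 1)\<close>, and dividing \<open>e1\<close> by \<open>a\<close> turns the
  eigenvalue \<open>a + 1\<close> on \<open>e2\<close> into \<open>1 + 1 / a\<close>.\<close>

lemma P06_orbit_unital_form:
  assumes "a \<noteq> 0" "a \<noteq> -1"
  shows "unital_form a b \<in> orbit (P06 (1 + 1 / a))"
proof (rule orbit_sym, rule orbitI[OF form_in_Bil2(7) form_in_Bil2(4)])
  show "area (a *s e1 + (b / (a + 1)) *s e2) e2 \<noteq> 0" using assms by (simp add: area_def)
qed (use assms in \<open>simp_all add: unital_form_def P06_def mult_table_def frame_def vec2_eq_iff
       divide_simps add_eq_0_iff2\<close>)

lemma P08_orbit_simple_form:
  assumes "d \<noteq> 0"
  shows "simple_form d \<in> orbit P08"
proof -
  \<comment> \<open>In \<open>P08\<close> the second vector below has square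
    \<open>- (t * t / 2) *s e2\<close>, which must equal \<open>d\<close> times the first vector
    \<open>2 *s e2\<close>.\<close>
  define t where "t = csqrt (- 4 * d)"
  have t: "t * t = - 4 * d" unfolding t_def by (metis power2_csqrt power2_eq_square)
  then have "t \<noteq> 0" using assms by auto
  then have "area (2 *s e2) (- (t / 2) *s e1 + t *s e2) \<noteq> 0" by (simp add: area_def)
  then have "P08 \<in> orbit (simple_form d)"
    by (rule orbitI[OF form_in_Bil2(9) form_in_Bil2(5)])
      (simp_all add: simple_form_def P08_def mult_table_def frame_def vec2_eq_iff algebra_simps t)
  then show ?thesis by (rule orbit_sym)
qed

section \<open>Position of the structures relative to the loci\<close>

lemma forms_in_loci:
  "zinbiel_form a b \<in> commutative_locus" "zinbiel_form a b \<in> discriminant_locus"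
  "zinbiel_form 0 b \<in> annihilator_locus"
  "cyclic_form r s \<in> commutative_locus" "cyclic_form r s \<in> annihilator_locus"
  "cyclic_form 0 s \<in> singular_locus" "cyclic_form r 0 \<in> singular_locus"
  "cyclic_form r r \<in> discriminant_locus"
  "left_form a b \<in> singular_locus" "left_form a b \<in> annihilator_locus"
  "unital_form a b \<in> discriminant_locus" "unital_form a b \<in> annihilator_locus"
  unfolding locus_defs
  by (intro CollectI conjI allI form_in_Bil2;
      simp add: form_defs mult_table_def area_def vec2_eq_iff power2_eq_square algebra_simps)+

text \<open>The ratio in \<open>trace_locus\<close> is read off \<open>P08\<close>: the traces of
  left and right multiplication are 3 and 2 for \<open>e1\<close>, and 3/2 and 1 for
  \<open>e2\<close>.\<close>

lemma P_in_loci: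
  "P05 \<alpha> \<in> singular_locus" "P05 \<alpha> \<in> annihilator_locus"
  "P06 \<alpha> \<in> discriminant_locus" "P06 \<alpha> \<in> annihilator_locus"
  "P07 \<in> commutative_locus" "P07 \<in> annihilator_locus"
  "P08 \<in> trace_locus" "P08 \<in> annihilator_locus"
  "P10 \<in> commutative_locus" "P10 \<in> discriminant_locus"
  unfolding locus_defs
  by (intro CollectI conjI allI form_in_Bil2;
      simp add: P_defs mult_table_def area_def vec2_eq_iff power2_eq_square algebra_simps)+

lemma not_commutative: "snd T x y \<noteq> snd T y x \<Longrightarrow> T \<notin> commutative_locus"
  by (auto simp: commutative_locus_def)

lemma not_singular: "area (snd T y x) (snd T z x) \<noteq> 0 \<Longrightarrow> T \<notin> singular_locus"
  by (auto simp: singular_locus_def)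

lemma not_discriminant:
  "(area (snd T y x) z + area y (snd T z x))\<^sup>2 \<noteq> 4 * area (snd T y x) (snd T z x) * area y z
    \<Longrightarrow> T \<notin> discriminant_locus"
  by (auto simp: discriminant_locus_def)

lemma not_trace:
  "2 * (area (snd T x y) z + area y (snd T x z)) \<noteq> 3 * (area (snd T y x) z + area y (snd T z x))
    \<Longrightarrow> T \<notin> trace_locus"
  by (auto simp: trace_locus_def)

lemma not_annihilator: "fst T x (snd T y z) \<noteq> 0 \<Longrightarrow> T \<notin> annihilator_locus"
  by (auto simp: annihilator_locus_def)

lemmas P_simps = P_defs area_def vec2_eq_iff

text \<open>\<open>e1 + e2\<close> is the unit, so its multiplication is invertible; multiplication
  by \<open>e1\<close> has the distinct eigenvalues 1 and 0 and nonzero trace.\<close>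

lemma P07_notin: "P07 \<notin> trace_locus" "P07 \<notin> singular_locus" "P07 \<notin> discriminant_locus"
  by (rule not_trace[where x = e1 and y = e1 and z = e2] not_singular[where x = "e1 + e2" and y = e1 and z = e2]
      not_discriminant[where x = e1 and y = e1 and z = e2]; simp add: P_simps mult_table_def)+

text \<open>Right multiplication by \<open>e1\<close> is a Jordan block with eigenvalue 1, which
  suits only the determinant; that of \<open>e2\<close> has the eigenvalues 0 and 1.\<close>

lemma P08_notin: "P08 \<notin> commutative_locus" "P08 \<notin> singular_locus" "P08 \<notin> discriminant_locus"
  by (rule not_commutative[where x = e1 and y = e2] not_singular[where x = e1 and y = e1 and z = e2]
      not_discriminant[where x = e2 and y = e1 and z = e2]; simp add: P_simps)+

lemma P10_notin: "P10 \<notin> annihilator_locus"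
  by (rule not_annihilator[where x = e1 and y = e1 and z = e1]) (simp add: P_simps)

text \<open>In this family the parameter 0 gives a commutative product and 1/2 satisfies the trace
  condition; the sample 1 avoids both.\<close>

lemma P05_notin: "P05 1 \<notin> commutative_locus" "P05 1 \<notin> trace_locus" "P05 1 \<notin> discriminant_locus"
  by (rule not_commutative[where x = e1 and y = e2] not_trace[where x = e1 and y = e1 and z = e2]
      not_discriminant[where x = e1 and y = e1 and z = e2]; simp add: P_simps)+

text \<open>The exceptional parameters here are 1, which is commutative, and 2, which satisfies the
  trace condition; the sample 0 avoids both.\<close>

lemma P06_notin: "P06 0 \<notin> commutative_locus" "P06 0 \<notin> trace_locus" "P06 0 \<notin> singular_locus"
  by (rule not_commutative[where x = e1 and y = e2] not_trace[where x = e1 and y = e1 and z = e2]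
      not_singular[where x = e1 and y = e1 and z = e2]; simp add: P_simps)+

lemma P_in_variety:
  "P05 \<alpha> \<in> pre_poisson_variety" "P06 \<alpha> \<in> pre_poisson_variety" "P07 \<in> pre_poisson_variety"
  "P08 \<in> pre_poisson_variety" "P10 \<in> pre_poisson_variety"
  unfolding variety_eq
  by (intro CollectI conjI allI form_in_Bil2;
      simp add: P_defs mult_table_def vec2_eq_iff field_simps)+

section \<open>Classification\<close>

lemma varietyD:
  assumes "T \<in> pre_poisson_variety"
  shows "fst T x (fst T y z) = fst T (fst T y x + fst T x y) z"
    "snd T (snd T x y) z - snd T (snd T y x) z = snd T x (snd T y z) - snd T y (snd T x z)"
    "fst T (snd T x y - snd T y x) z = snd T x (fst T y z) - fst T y (snd T x z)"
    "snd T (fst T x y + fst T y x) z = fst T x (snd T y z) + fst T y (snd T x z)"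
  using assms unfolding variety_eq by blast+

lemma snd_mult_table:
  assumes "T \<in> pre_poisson_variety"
  obtains a b c d where "snd T = mult_table a b c d"
proof -
  have "cbilinear (snd T)" using subsetD[OF variety_subset assms] by (simp add: Bil2_iff)
  then show ?thesis by (rule that[OF cbilinear_eq_mult_table])
qed

text \<open>The Zinbiel identity gives the square of \<open>e2\<close> twice in terms of
  \<open>c\<close>, the product of \<open>e2\<close> with \<open>e1\<close>; comparison forces
  \<open>c = 0\<close>, and all dot products of three factors vanish. The two mixed identities then
  determine the circle product from the square of \<open>e1\<close>.\<close>

lemma zinbiel_of_cyclic:
  assumes T: "T \<in> pre_poisson_variety" and cyclic: "fst T e1 e1 = e2"
  shows "\<exists>a b. T = zinbiel_form a b"
proof -
  obtain a b c d a' b' c' d' where Teq: "T = (mult_table a b c d, mult_table a' b' c' d')"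
    using Bil2_cases T variety_subset by (metis subsetD)
  then have a: "a = e2" using cyclic by simp
  note eqs = varietyD[OF T, unfolded Teq a fst_conv snd_conv]
  have b: "b $ 1 = 2 * c $ 1" "b $ 2 = 2 * c $ 2"
    using eqs(1)[of e1 e1 e1] by (simp_all add: mult_table_def vec2_eq_iff)
  have "2 * d $ 1 = 2 * (2 * (c $ 1 * c $ 2))" "2 * d $ 2 = 2 * (c $ 1 + 2 * (c $ 2 * c $ 2))"
    using eqs(1)[of e1 e1 e2] by (simp_all add: mult_table_def vec2_eq_iff b algebra_simps)
  then have d: "d $ 1 = 2 * (c $ 1 * c $ 2)" "d $ 2 = c $ 1 + 2 * (c $ 2 * c $ 2)"
    unfolding mult_cancel_left by simp_all
  have d': "d $ 1 = 3 * (c $ 1 * c $ 2)" "d $ 2 = 3 * c $ 1 + 3 * (c $ 2 * c $ 2)"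
    using eqs(1)[of e2 e1 e1] by (simp_all add: mult_table_def vec2_eq_iff b algebra_simps)
  have "c $ 1 * c $ 2 = 0" using d(1) d'(1) by simp
  moreover have "c $ 2 * c $ 2 = - 2 * c $ 1" using d(2) d'(2) by algebra
  ultimately have c: "c $ 1 = 0" "c $ 2 = 0" by auto
  have zero: "b = 0" "c = 0" "d = 0" using b c d by (simp_all add: vec2_eq_iff)
  have "b' = a' $ 1 *s e2" using eqs(3)[of e1 e1 e1] by (simp add: zero mult_table_def vec2_eq_iff)
  moreover have "c' = a' $ 1 *s e2" using eqs(4)[of e1 e1 e1] by (simp add: zero mult_table_def vec2_eq_iff)
  moreover from calculation have "d' = 0" using eqs(4)[of e1 e1 e2] by (simp add: zero mult_table_def vec2_eq_iff)
  ultimately have "T = zinbiel_form (a' $ 1) (a' $ 2)"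
    using V_expand[of a'] by (simp add: Teq a zero zinbiel_form_def)
  then show ?thesis by blast
qed

text \<open>A vector with square \<open>k *s x\<close> satisfies \<open>k * k = 2 * k * k\<close>,
  so \<open>e1\<close> and \<open>e2\<close> have square zero. Polarising at \<open>e1 + e2\<close>
  and \<open>e1 - e2\<close> makes the product alternating; the symmetrised product in the identity
  is then zero, which leaves \<open>x (y z) = 0\<close>.\<close>

lemma zinbiel_zero:
  assumes T: "T \<in> pre_poisson_variety" and noncyclic: "\<And>u. area u (fst T u u) = 0"
  shows "fst T = mult_table 0 0 0 0"
proof -
  obtain a b c d a' b' c' d' where Teq: "T = (mult_table a b c d, mult_table a' b' c' d')"
    using Bil2_cases T variety_subset by (metis subsetD)
  note eqs = varietyD(1)[OF T, unfolded Teq fst_conv]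
  note nc = noncyclic[unfolded Teq fst_conv]
  have "a $ 2 = 0" using nc[of e1] by (simp add: area_def)
  moreover from this have "a $ 1 = 0" using eqs[of e1 e1 e1] by (simp add: mult_table_def vec2_eq_iff)
  ultimately have a: "a = 0" by (simp add: vec2_eq_iff)
  have "d $ 1 = 0" using nc[of e2] by (simp add: area_def)
  moreover from this have "d $ 2 = 0" using eqs[of e2 e2 e2] by (simp add: mult_table_def vec2_eq_iff)
  ultimately have d: "d = 0" by (simp add: vec2_eq_iff)
  have "b $ 2 + c $ 2 = b $ 1 + c $ 1"
    using nc[of "e1 + e2"] by (simp add: area_def mult_table_def a d algebra_simps)
  moreover have "b $ 2 + c $ 2 = - (b $ 1 + c $ 1)"
    using nc[of "e1 - e2"] by (simp add: area_def mult_table_def a d algebra_simps) algebra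
  ultimately have "c $ 1 = - b $ 1" "c $ 2 = - b $ 2" by (algebra, algebra)
  then have c: "c = - b" by (simp add: vec2_eq_iff)
  have "b $ 1 = 0"
    using eqs[of e2 e1 e2] by (auto simp: mult_table_def vec2_eq_iff a c d)
  moreover have "b $ 2 = 0"
    using eqs[of e1 e1 e2] by (auto simp: mult_table_def vec2_eq_iff a c d)
  ultimately have "b = 0" by (simp add: vec2_eq_iff)
  then show ?thesis by (simp add: Teq a c d)
qed

text \<open>A commutative pre-Lie product is associative, so \<open>e1\<close> and \<open>e2\<close>
  behave as \<open>X\<close> and its square, and the third power of \<open>X\<close> gives the
  defining relation.\<close>

lemma commutative_of_cyclic:
  assumes T: "T \<in> pre_poisson_variety" and zero: "fst T = mult_table 0 0 0 0"
    and comm: "snd T e1 e2 = snd T e2 e1" and cyclic: "snd T e1 e1 = e2"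
  shows "\<exists>r s. T = cyclic_form r s"
proof -
  obtain a b c d where snd: "snd T = mult_table a b c d"
    by (rule snd_mult_table[OF T])
  then have a: "a = e2" "c = b" using cyclic comm by simp_all
  note eqs = varietyD(2)[OF T, unfolded snd a]
  \<comment> \<open>A square root of the discriminant of \<open>X * X - b $ 2 * X - b $ 1\<close>,
    whose roots are \<open>r\<close> and \<open>s\<close>.\<close>
  define t where "t = csqrt ((b $ 2)\<^sup>2 + 4 * b $ 1)"
  have t: "t * t = (b $ 2)\<^sup>2 + 4 * b $ 1" unfolding t_def by (metis power2_csqrt power2_eq_square)
  define r s where "r = (b $ 2 + t) / 2" and "s = (b $ 2 - t) / 2"
  have rs: "r + s = b $ 2" "- (r * s) = b $ 1"
    using t by (simp_all add: r_def s_def field_simps power2_eq_square)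
  have b: "b = - (r * s) *s e1 + (r + s) *s e2" unfolding rs by (rule V_expand)
  have "d = b $ 1 *s e2 + b $ 2 *s b"
    using eqs[of e1 e2 e1] by (simp add: mult_table_def vec2_eq_iff)
  then have "d = - (r * s * (r + s)) *s e1 + ((r + s)\<^sup>2 - r * s) *s e2"
    unfolding rs(1)[symmetric] rs(2)[symmetric] vec2_eq_iff
    by (simp add: rs(1)[symmetric] rs(2)[symmetric] power2_eq_square algebra_simps)
  then have "T = cyclic_form r s"
    by (simp only: cyclic_form_def a snd zero prod_eq_iff fst_conv snd_conv flip: b)
  then show ?thesis by blast
qed

lemma commutative_zero:
  assumes T: "T \<in> pre_poisson_variety" and zero: "fst T = mult_table 0 0 0 0"
    and comm: "snd T e1 e2 = snd T e2 e1" and noncyclic: "\<And>u. area u (snd T u u) = 0"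
  shows "T = (mult_table 0 0 0 0, mult_table 0 0 0 0)"
proof -
  obtain a b c d where snd: "snd T = mult_table a b c d"
    by (rule snd_mult_table[OF T])
  then have c: "c = b" using comm by simp
  note eqs = varietyD(2)[OF T, unfolded snd c]
  note nc = noncyclic[unfolded snd c]
  have ad: "a $ 2 = 0" "d $ 1 = 0" using nc[of e1] nc[of e2] by (simp_all add: area_def)
  have 1: "d $ 2 + 2 * b $ 2 = a $ 1 + 2 * b $ 1"
    using nc[of "e1 + e2"] by (simp add: area_def mult_table_def ad algebra_simps)
  have 2: "d $ 2 - 2 * b $ 2 = 2 * b $ 1 - a $ 1"
    using nc[of "e1 - e2"] by (simp add: area_def mult_table_def ad algebra_simps)
  \<comment> \<open>A quadratic map that preserves every line is a linear form times the identity: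
    here the square of \<open>x\<close> is \<open>2 * (b $ 2 * x $ 1 + b $ 1 * x $ 2)\<close> times
    \<open>x\<close>. The pre-Lie identity kills this form.\<close>
  have ad': "a $ 1 = 2 * b $ 2" "d $ 2 = 2 * b $ 1" using 1 2 by (algebra, algebra)
  have "b $ 2 = 0"
    using eqs[of e1 e2 e1] by (simp add: mult_table_def vec2_eq_iff ad ad' algebra_simps)
  moreover have "b $ 1 = 0"
    using eqs[of e1 e2 e2] by (simp add: mult_table_def vec2_eq_iff ad ad' algebra_simps)
  ultimately have "a = 0" "b = 0" "d = 0" using ad ad' by (simp_all add: vec2_eq_iff)
  then show ?thesis by (simp add: zero snd c prod_eq_iff)
qed

text \<open>If \<open>[u, v] = v\<close>, then \<open>L\<^sub>v = [L\<^sub>u, L\<^sub>v]\<close>; the four equations are the matrix entries.\<close>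

lemma noncommutative_equations:
  assumes T: "T \<in> pre_poisson_variety" and snd: "snd T = mult_table a b c d" and bracket: "b - c = e2"
  shows "d $ 2 = - b $ 1" "b $ 1 * (b $ 2 - 1) - d $ 1 * a $ 2 = b $ 1"
    "d $ 1 * (a $ 1 - b $ 2 - 1) = 2 * (b $ 1)\<^sup>2"
    "2 * (a $ 2 * b $ 1) + (b $ 2 - 1) * (b $ 2 - a $ 1 - 1) = 0"
proof -
  have c: "c $ 1 = b $ 1" "c $ 2 = b $ 2 - 1" using bracket by (simp_all add: vec2_eq_iff algebra_simps)
  note eqs = varietyD(2)[OF T, unfolded snd, of e1 e2]
  note entries = eqs[of e1] eqs[of e2]
  have 1: "b $ 1 = b $ 1 * (b $ 2 - 1) - d $ 1 * a $ 2"
    and 2: "b $ 2 - 1 = a $ 2 * b $ 1 + b $ 2 * (b $ 2 - 1) - (b $ 2 - 1) * a $ 1 - d $ 2 * a $ 2"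
    using entries(1) by (simp_all add: mult_table_def vec2_eq_iff c algebra_simps)
  have 3: "d $ 1 = a $ 1 * d $ 1 + b $ 1 * d $ 2 - b $ 1 * b $ 1 - d $ 1 * b $ 2"
    and 4: "d $ 2 = a $ 2 * d $ 1 + b $ 2 * d $ 2 - (b $ 2 - 1) * b $ 1 - d $ 2 * b $ 2"
    using entries(2) by (simp_all add: mult_table_def vec2_eq_iff c algebra_simps)
  \<comment> \<open>A commutator has trace zero, and left multiplication by \<open>e2\<close> has
    trace \<open>c $ 1 + d $ 2\<close>.\<close>
  show d: "d $ 2 = - b $ 1" using 1 4 by algebra
  show "b $ 1 * (b $ 2 - 1) - d $ 1 * a $ 2 = b $ 1" using 1 by simp
  show "d $ 1 * (a $ 1 - b $ 2 - 1) = 2 * (b $ 1)\<^sup>2" using 3 d by algebra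
  show "2 * (a $ 2 * b $ 1) + (b $ 2 - 1) * (b $ 2 - a $ 1 - 1) = 0" using 2 d by algebra
qed

lemma noncommutative_forms:
  assumes T: "T \<in> pre_poisson_variety" and zero: "fst T = mult_table 0 0 0 0"
    and snd: "snd T = mult_table a b c d" and bracket: "b - c = e2" and b1: "b $ 1 = 0"
  shows "T = left_form (a $ 1) (a $ 2) \<or> T = unital_form (a $ 1) (a $ 2) \<or>
    (d $ 1 \<noteq> 0 \<and> T = simple_form (d $ 1))"
proof -
  have c: "c = b - e2" using bracket by (simp add: algebra_simps)
  note eqs = noncommutative_equations[OF T snd bracket, unfolded b1, simplified]
  have b: "b = b $ 2 *s e2" using b1 by (simp add: vec2_eq_iff)
  have d: "d = d $ 1 *s e1" using eqs(1) by (simp add: vec2_eq_iff)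
  have a: "a = a $ 1 *s e1 + a $ 2 *s e2" by (rule V_expand)
  show ?thesis
  proof (cases "d $ 1 = 0")
    case True
    then have d: "d = 0" using d by simp
    consider "b $ 2 = 1" | "b $ 2 = a $ 1 + 1" using eqs(4) by (auto simp: algebra_simps)
    then show ?thesis
    proof cases
      case 1
      then have "b = e2" using b1 by (simp add: vec2_eq_iff)
      then have "T = left_form (a $ 1) (a $ 2)"
        using c d by (simp add: left_form_def prod_eq_iff zero snd flip: a)
      then show ?thesis ..
    next
      case 2
      then have "b = (a $ 1 + 1) *s e2" "c = a $ 1 *s e2" using b1 c by (simp_all add: vec2_eq_iff)
      then have "T = unital_form (a $ 1) (a $ 2)"
        using d by (simp add: unital_form_def prod_eq_iff zero snd flip: a)
      then show ?thesis by simp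
    qed
  next
    case False
    then have a': "a $ 2 = 0" "a $ 1 = b $ 2 + 1" using eqs by (simp_all add: algebra_simps)
    then have "b $ 2 = 1" using eqs(4) by simp
    then have "a = 2 *s e1" "b = e2" "c = 0" using a' b1 c by (simp_all add: vec2_eq_iff)
    then have "T = simple_form (d $ 1)"
      by (simp add: simple_form_def prod_eq_iff zero snd flip: d)
    then show ?thesis using False by simp
  qed
qed

lemma frame_eq_iff: "area u v \<noteq> 0 \<Longrightarrow> frame u v x = frame u v y \<longleftrightarrow> x = y"
  by (metis coframe_frame)

lemma change_frame_zero:
  assumes T: "T \<in> pre_poisson_variety" and uv: "area u v \<noteq> 0" and zero: "fst T = mult_table 0 0 0 0"
  obtains T' where "T' \<in> pre_poisson_variety" "T \<in> orbit T'" "fst T' = mult_table 0 0 0 0"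
    "\<And>x y. snd T (frame u v x) (frame u v y) = frame u v (snd T' x y)"
proof (rule change_frame[OF T uv])
  fix T' assume T': "T' \<in> pre_poisson_variety" "T \<in> orbit T'"
    "\<And>x y. fst T (frame u v x) (frame u v y) = frame u v (fst T' x y)"
    "\<And>x y. snd T (frame u v x) (frame u v y) = frame u v (snd T' x y)"
  have "fst T' x y = 0" for x y
    using T'(3)[of x y] frame_eq_iff[OF uv, of "fst T' x y" 0] by (simp add: zero mult_table_zero clinear2D)
  then have "fst T' = mult_table 0 0 0 0" by (simp add: mult_table_zero fun_eq_iff)
  then show thesis using that T' by iprover
qed

lemma mult_table_bracket:
  "mult_table a b c d x y - mult_table a b c d y x = area x y *s (b - c)"
  by (simp add: mult_table_def area_def vec2_eq_iff algebra_simps)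

lemma bracket_forms:
  assumes T: "T \<in> pre_poisson_variety" and zero: "fst T = mult_table 0 0 0 0"
    and bracket: "snd T e1 e2 - snd T e2 e1 = e2"
  shows "(\<exists>a b. T \<in> orbit (left_form a b)) \<or> (\<exists>a b. T \<in> orbit (unital_form a b)) \<or> T \<in> orbit P08"
proof -
  have forms: "(\<exists>a b. T \<in> orbit (left_form a b)) \<or> (\<exists>a b. T \<in> orbit (unital_form a b)) \<or> T \<in> orbit P08"
    if T': "T' \<in> pre_poisson_variety" "T \<in> orbit T'" and zero': "fst T' = mult_table 0 0 0 0"
      and snd': "snd T' = mult_table a b c d" and bracket': "b - c = e2" "b $ 1 = 0" for T' a b c d
    using noncommutative_forms[OF T'(1) zero' snd' bracket'] T'(2)
      P08_orbit_simple_form[of "d $ 1"] orbit_trans[of T' P08 T] by metis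
  obtain a b c d where snd: "snd T = mult_table a b c d"
    by (rule snd_mult_table[OF T])
  have bc: "b - c = e2" using bracket by (simp add: snd)
  note eqs = noncommutative_equations[OF T snd bc]
  show ?thesis
  proof (cases "d $ 1 = 0")
    case True
    then have "b $ 1 = 0" using eqs(3) by simp
    then show ?thesis using forms[OF T orbit_refl zero snd bc] T variety_subset by (meson subsetD)
  next
    case False
    \<comment> \<open>The shift along \<open>e2\<close> keeps the bracket. Since
      \<open>d $ 2 = - b $ 1\<close>, the square of \<open>e2\<close> becomes \<open>d $ 1\<close>
      times the new first vector, and the trace equation in the new frame then gives
      \<open>b' $ 1 = 0\<close>.\<close>
    define u where "u = e1 - (b $ 1 / d $ 1) *s e2"
    have area1: "area u e2 = 1" by (simp add: u_def area_def)
    then have uv: "area u e2 \<noteq> 0" by simp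
    obtain T' where T': "T' \<in> pre_poisson_variety" "T \<in> orbit T'" "fst T' = mult_table 0 0 0 0"
      and snd': "\<And>x y. snd T (frame u e2 x) (frame u e2 y) = frame u e2 (snd T' x y)"
      by (rule change_frame_zero[OF T uv zero]) (rule that)
    obtain a' b' c' d' where mt: "snd T' = mult_table a' b' c' d'"
      by (rule snd_mult_table[OF T'(1)])
    have "frame u e2 d' = d" using snd'[of e2 e2] by (simp add: mt snd)
    also have "\<dots> = frame u e2 (d $ 1 *s e1)"
      using False eqs(1) by (simp add: frame_def u_def vec2_eq_iff)
    finally have "d' = d $ 1 *s e1" by (simp add: frame_eq_iff[OF uv])
    moreover have "frame u e2 (b' - c') = frame u e2 e2"
      using snd'[of e1 e2] snd'[of e2 e1] mult_table_bracket[of a b c d u e2] area1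
      by (simp add: mt snd bc clinear2D)
    then have bc': "b' - c' = e2" by (simp only: frame_eq_iff[OF uv])
    ultimately have "b' $ 1 = 0" using noncommutative_equations(1)[OF T'(1) mt bc'] by simp
    then show ?thesis using forms[OF T' mt bc'] by simp
  qed
qed

lemma classification:
  assumes T: "T \<in> pre_poisson_variety"
  obtains (zinbiel) a b where "T \<in> orbit (zinbiel_form a b)"
  | (cyclic) r s where "T \<in> orbit (cyclic_form r s)"
  | (zero) "T = (mult_table 0 0 0 0, mult_table 0 0 0 0)"
  | (left) a b where "T \<in> orbit (left_form a b)"
  | (unital) a b where "T \<in> orbit (unital_form a b)"
  | (P08) "T \<in> orbit P08"
proof (cases "\<forall>u. area u (fst T u u) = 0")
  case False
  then obtain u where u: "area u (fst T u u) \<noteq> 0" by blast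
  show thesis
  proof (rule change_frame[OF T u])
    let ?f = "frame u (fst T u u)"
    fix T' assume T': "T' \<in> pre_poisson_variety" "T \<in> orbit T'"
      and fst': "\<And>x y. fst T (?f x) (?f y) = ?f (fst T' x y)"
    have "?f (fst T' e1 e1) = ?f e2" using fst'[of e1 e1] by simp
    then have "fst T' e1 e1 = e2" by (simp only: frame_eq_iff[OF u])
    then show thesis using zinbiel_of_cyclic[OF T'(1)] T'(2) zinbiel by metis
  qed
next
  case True
  then have fst0: "fst T = mult_table 0 0 0 0" using zinbiel_zero[OF T] by simp
  obtain a b c d where snd: "snd T = mult_table a b c d"
    by (rule snd_mult_table[OF T])
  have bracket: "snd T x y - snd T y x = area x y *s (b - c)" for x y
    by (simp only: snd mult_table_bracket)
  consider (noncomm) "b - c \<noteq> 0" | (comm_cyclic) u where "b = c" "area u (snd T u u) \<noteq> 0"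
    | (comm) "b = c" "\<forall>u. area u (snd T u u) = 0" by auto
  then show thesis
  proof cases
    case noncomm
    define w where "w = b - c"
    \<comment> \<open>All brackets are multiples of \<open>w\<close>, namely
      \<open>[x, y] = area x y *s w\<close>, so \<open>area u w = 1\<close> yields
      \<open>[u, w] = w\<close>.\<close>
    define u where "u = (if w $ 2 \<noteq> 0 then (1 / w $ 2) *s e1 else (- 1 / w $ 1) *s e2)"
    have uw: "area u w = 1"
      using noncomm by (auto simp: u_def area_def vec2_eq_iff simp flip: w_def)
    then have uw0: "area u w \<noteq> 0" by simp
    obtain T' where T': "T' \<in> pre_poisson_variety" "T \<in> orbit T'" "fst T' = mult_table 0 0 0 0"
      and snd': "\<And>x y. snd T (frame u w x) (frame u w y) = frame u w (snd T' x y)"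
      by (rule change_frame_zero[OF T uw0 fst0]) (rule that)
    have "frame u w (snd T' e1 e2 - snd T' e2 e1) = frame u w e2"
      using snd'[of e1 e2] snd'[of e2 e1] bracket[of u w] by (simp add: clinear2D uw flip: w_def)
    then have "snd T' e1 e2 - snd T' e2 e1 = e2" by (simp only: frame_eq_iff[OF uw0])
    from bracket_forms[OF T'(1,3) this] T'(2) show thesis
      using left unital P08 orbit_trans by (metis (no_types))
  next
    case comm_cyclic
    let ?f = "frame u (snd T u u)"
    obtain T' where T': "T' \<in> pre_poisson_variety" "T \<in> orbit T'" "fst T' = mult_table 0 0 0 0"
      and snd': "\<And>x y. snd T (?f x) (?f y) = ?f (snd T' x y)"
      by (rule change_frame_zero[OF T comm_cyclic(2) fst0]) (rule that)
    have "?f (snd T' e1 e1) = ?f e2" using snd'[of e1 e1] by simp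
    then have "snd T' e1 e1 = e2" by (simp only: frame_eq_iff[OF comm_cyclic(2)])
    moreover have "?f (snd T' e1 e2) = ?f (snd T' e2 e1)"
      using bracket[of "?f e1" "?f e2"] comm_cyclic(1) by (simp flip: snd')
    then have "snd T' e1 e2 = snd T' e2 e1" by (simp only: frame_eq_iff[OF comm_cyclic(2)])
    ultimately show thesis using commutative_of_cyclic[OF T'(1,3)] T'(2) cyclic by metis
  next
    case comm
    then show thesis using commutative_zero[OF T fst0] zero by (simp add: snd)
  qed
qed

section \<open>Closures of the orbits\<close>

lemma family_orbit: "T \<in> (\<Union>\<alpha>. orbit (P \<alpha>)) \<Longrightarrow> R \<in> orbit T \<Longrightarrow> R \<in> (\<Union>\<alpha>. orbit (P \<alpha>))"
  by (erule UN_E, rule UN_I[OF UNIV_I], erule (1) orbit_trans)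

lemma family_in_Bil2: "(\<And>\<alpha>. P \<alpha> \<in> Bil2) \<Longrightarrow> (\<Union>\<alpha>. orbit (P \<alpha>)) \<subseteq> Bil2"
  by (intro UN_least orbit_in_Bil2)

lemma zinbiel_form_closure: "zinbiel_form a b \<in> zariski closure_of orbit P10"
proof -
  define \<gamma> where "\<gamma> z = zinbiel_form (a + z) b" for z
  have "\<gamma> 0 \<in> zariski closure_of orbit P10"
  proof (rule curve_in_closure)
    show "rational_curve (\<lambda>z. 1) \<gamma>"
      unfolding \<gamma>_def zinbiel_form_def by (intro rational_curve_mult_table polyfun_intros)
    have "z \<in> {- a}" if "\<gamma> z \<notin> orbit P10" for z
    proof -
      have "a + z = 0" using that P10_orbit_zinbiel_form[of "a + z" b] unfolding \<gamma>_def by blast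
      then show ?thesis by (simp add: eq_neg_iff_add_eq_0 add.commute)
    qed
    then have "{z. \<gamma> z \<notin> orbit P10} \<subseteq> {- a}" by blast
    then show "finite {z. \<gamma> z \<notin> orbit P10}" by (rule finite_subset) simp
  qed (simp_all add: \<gamma>_def orbit_in_Bil2)
  then show ?thesis by (simp add: \<gamma>_def)
qed

lemma cyclic_form_closure: "cyclic_form r s \<in> zariski closure_of orbit P07"
proof -
  \<comment> \<open>The different speeds 1 and 2 separate the two roots even if
    \<open>r = s\<close>, and both move off 0.\<close>
  define \<gamma> where "\<gamma> z = cyclic_form (r + z) (s + 2 * z)" for z
  have "\<gamma> 0 \<in> zariski closure_of orbit P07"
  proof (rule curve_in_closure)
    show "rational_curve (\<lambda>z. 1) \<gamma>"
      unfolding \<gamma>_def cyclic_form_def by (intro rational_curve_mult_table polyfun_intros)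
    have "z \<in> {- r, - s / 2, r - s}" if "\<gamma> z \<notin> orbit P07" for z
    proof -
      have "r + z = 0 \<or> s + 2 * z = 0 \<or> r + z = s + 2 * z"
        using that P07_orbit_cyclic_form[of "r + z" "s + 2 * z"] unfolding \<gamma>_def by blast
      then show ?thesis by (auto simp: field_simps eq_neg_iff_add_eq_0)
    qed
    then have "{z. \<gamma> z \<notin> orbit P07} \<subseteq> {- r, - s / 2, r - s}" by blast
    then show "finite {z. \<gamma> z \<notin> orbit P07}" by (rule finite_subset) simp
  qed (simp_all add: \<gamma>_def orbit_in_Bil2)
  then show ?thesis by (simp add: \<gamma>_def)
qed

lemma left_form_closure: "left_form a b \<in> zariski closure_of (\<Union>\<alpha>. orbit (P05 \<alpha>))"
proof -
  let ?S = "\<Union>\<alpha>. orbit (P05 \<alpha>)"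
  define \<gamma> where "\<gamma> z = left_form (a + z) b" for z
  have "\<gamma> 0 \<in> zariski closure_of ?S"
  proof (rule curve_in_closure)
    show "rational_curve (\<lambda>z. 1) \<gamma>"
      unfolding \<gamma>_def left_form_def by (intro rational_curve_mult_table polyfun_intros)
    have "z \<in> {- a, 1 - a}" if "\<gamma> z \<notin> ?S" for z
    proof -
      have "a + z = 0 \<or> a + z = 1"
        using that P05_orbit_left_form[of "a + z" b] unfolding \<gamma>_def by blast
      then show ?thesis by (auto simp: field_simps eq_neg_iff_add_eq_0)
    qed
    then have "{z. \<gamma> z \<notin> ?S} \<subseteq> {- a, 1 - a}" by blast
    then show "finite {z. \<gamma> z \<notin> ?S}" by (rule finite_subset) simp
  qed (simp_all add: \<gamma>_def family_in_Bil2)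
  then show ?thesis by (simp add: \<gamma>_def)
qed

lemma unital_form_closure: "unital_form a b \<in> zariski closure_of (\<Union>\<alpha>. orbit (P06 \<alpha>))"
proof -
  let ?S = "\<Union>\<alpha>. orbit (P06 \<alpha>)"
  define \<gamma> where "\<gamma> z = unital_form (a + z) b" for z
  have "\<gamma> 0 \<in> zariski closure_of ?S"
  proof (rule curve_in_closure)
    show "rational_curve (\<lambda>z. 1) \<gamma>"
      unfolding \<gamma>_def unital_form_def by (intro rational_curve_mult_table polyfun_intros)
    have "z \<in> {- a, - 1 - a}" if "\<gamma> z \<notin> ?S" for z
    proof -
      have "a + z = 0 \<or> a + z = -1"
        using that P06_orbit_unital_form[of "a + z" b] unfolding \<gamma>_def by blast
      then show ?thesis by (auto simp: field_simps eq_neg_iff_add_eq_0)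
    qed
    then have "{z. \<gamma> z \<notin> ?S} \<subseteq> {- a, - 1 - a}" by blast
    then show "finite {z. \<gamma> z \<notin> ?S}" by (rule finite_subset) simp
  qed (simp_all add: \<gamma>_def family_in_Bil2)
  then show ?thesis by (simp add: \<gamma>_def)
qed

text \<open>The zero structure has no cyclic vector, so it is not a \<open>cyclic_form\<close>. It
  is the limit of \<open>P07\<close> with its product multiplied by \<open>z\<close>, and rescaling
  both idempotents by \<open>1 / z\<close> undoes the factor.\<close>

lemma zero_closure: "(mult_table 0 0 0 0, mult_table 0 0 0 0) \<in> zariski closure_of orbit P07"
proof -
  define \<gamma> where "\<gamma> z = (mult_table 0 0 0 0, mult_table (z *s e1) 0 0 (z *s e2))" for z :: complex
  have "\<gamma> 0 \<in> zariski closure_of orbit P07"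
  proof (rule curve_in_closure)
    show "rational_curve (\<lambda>z. 1) \<gamma>"
      unfolding \<gamma>_def by (intro rational_curve_mult_table polyfun_intros)
    have "\<gamma> z \<in> orbit P07" if "z \<noteq> 0" for z
      unfolding \<gamma>_def using that
      by (intro orbitI[OF mult_table_in_Bil2 form_in_Bil2(8), of "(1 / z) *s e1" "(1 / z) *s e2"])
        (simp_all add: P07_def mult_table_def frame_def area_def vec2_eq_iff)
    then have "{z. \<gamma> z \<notin> orbit P07} \<subseteq> {0}" by blast
    then show "finite {z. \<gamma> z \<notin> orbit P07}" by (rule finite_subset) simp
  qed (simp_all add: \<gamma>_def orbit_in_Bil2)
  then show ?thesis by (simp add: \<gamma>_def)
qed

lemma closure_cover:
  assumes "T \<in> pre_poisson_variety"
  shows "T \<in> zariski closure_of (orbit P07) \<union> zariski closure_of (orbit P08) \<union>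
    zariski closure_of (orbit P10) \<union> zariski closure_of (\<Union>\<alpha>. orbit (P05 \<alpha>)) \<union>
    zariski closure_of (\<Union>\<alpha>. orbit (P06 \<alpha>))"
  using assms
proof (cases rule: classification)
  case (zinbiel a b)
  from orbit_in_closure[OF orbit_in_Bil2[OF form_in_Bil2(10)] orbit_trans zinbiel_form_closure this]
  show ?thesis by simp
next
  case (cyclic r s)
  from orbit_in_closure[OF orbit_in_Bil2[OF form_in_Bil2(8)] orbit_trans cyclic_form_closure this]
  show ?thesis by simp
next
  case zero
  then show ?thesis using zero_closure by simp
next
  case (left a b)
  from orbit_in_closure[OF family_in_Bil2[OF form_in_Bil2(6)] family_orbit left_form_closure this]
  show ?thesis by simp
next
  case (unital a b)
  from orbit_in_closure[OF family_in_Bil2[OF form_in_Bil2(7)] family_orbit unital_form_closure this]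
  show ?thesis by simp
next
  case P08
  have "orbit P08 \<subseteq> zariski closure_of (orbit P08)"
    by (rule closure_of_subset) (simp add: topspace_zariski orbit_in_Bil2)
  then show ?thesis using P08 by auto
qed

section \<open>Open orbits\<close>

lemma rigidI:
  assumes "P \<in> pre_poisson_variety" "zariski_closed Z" "P \<notin> Z"
    and invariant: "\<And>T S. T \<in> Z \<Longrightarrow> S \<in> orbit T \<Longrightarrow> S \<in> Z"
    and complement: "\<And>T. T \<in> pre_poisson_variety \<Longrightarrow> T \<notin> Z \<Longrightarrow> T \<in> orbit P"
  shows "rigid P"
proof -
  have "orbit P \<inter> Z = {}" using invariant assms(3) orbit_sym by blast
  moreover have "orbit P \<subseteq> pre_poisson_variety" using variety_orbit[OF assms(1)] by blast
  ultimately have "orbit P = (Bil2 - Z) \<inter> pre_poisson_variety"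
    using complement variety_subset by blast
  moreover have "openin zariski (Bil2 - Z)"
    using assms(2) by (simp add: openin_zariski double_diff[OF zariski_closed_subset order_refl])
  ultimately show ?thesis unfolding rigid_def openin_subtopology using assms(1) by blast
qed

lemma rigid_P10: "rigid P10"
proof (rule rigidI[of _ annihilator_locus])
  fix T assume T: "T \<in> pre_poisson_variety" "T \<notin> annihilator_locus"
  note inv = annihilator_locus_orbit[of _ T]
  show "T \<in> orbit P10"
    using T(1)
  proof (cases rule: classification)
    case (zinbiel a b)
    then have "a \<noteq> 0" using inv[OF forms_in_loci(3)] T(2) by auto
    then show ?thesis using orbit_trans[OF P10_orbit_zinbiel_form zinbiel] by simp
  next
    case zero
    then show ?thesis using T(2) by (simp add: annihilator_locus_def) (simp add: mult_table_zero)
  qed (use T(2) inv[OF forms_in_loci(5)] inv[OF forms_in_loci(10)] inv[OF forms_in_loci(12)]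
      inv[OF P_in_loci(8)] in blast)+
qed (simp_all add: P_in_variety locus_closed P10_notin annihilator_locus_orbit)

lemma rigid_P08: "rigid P08"
\<comment> \<open>Commutativity removes the Zinbiel, cyclic and zero structures,
  \<open>singular_locus\<close> the left forms and \<open>discriminant_locus\<close> the unital
  forms.\<close>
proof (rule rigidI[of _ "commutative_locus \<union> (singular_locus \<union> discriminant_locus)"])
  fix T assume T: "T \<in> pre_poisson_variety" "T \<notin> commutative_locus \<union> (singular_locus \<union> discriminant_locus)"
  note comm = commutative_locus_orbit[of _ T]
  show "T \<in> orbit P08"
    using T(1)
  proof (cases rule: classification)
    case zero
    then show ?thesis using T(2) by (simp add: commutative_locus_def) (simp add: mult_table_zero)
  qed (use T(2) comm[OF forms_in_loci(1)] comm[OF forms_in_loci(4)]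
      singular_locus_orbit[OF forms_in_loci(9)] discriminant_locus_orbit[OF forms_in_loci(11)] in blast)+
next
  fix T S assume "T \<in> commutative_locus \<union> (singular_locus \<union> discriminant_locus)" "S \<in> orbit T"
  then show "S \<in> commutative_locus \<union> (singular_locus \<union> discriminant_locus)"
    using commutative_locus_orbit singular_locus_orbit discriminant_locus_orbit by (metis Un_iff)
qed (simp_all add: P_in_variety locus_closed zariski_closed_Un P08_notin)

lemma rigid_P07: "rigid P07"
\<comment> \<open>In \<open>cyclic_form r s\<close> multiplication by a polynomial has its values at
  \<open>r\<close> and \<open>s\<close> as eigenvalues, so leaving the singular and discriminant
  loci makes 0, \<open>r\<close>, \<open>s\<close> distinct. The orbit of \<open>P08\<close> is
  removed by \<open>trace_locus\<close>.\<close>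
proof (rule rigidI[of _ "trace_locus \<union> (singular_locus \<union> discriminant_locus)"])
  fix T assume T: "T \<in> pre_poisson_variety" "T \<notin> trace_locus \<union> (singular_locus \<union> discriminant_locus)"
  show "T \<in> orbit P07"
    using T(1)
  proof (cases rule: classification)
    case (cyclic r s)
    have "r \<noteq> 0" "s \<noteq> 0" "r \<noteq> s"
      using T(2) cyclic singular_locus_orbit[OF forms_in_loci(6), where S = T]
        singular_locus_orbit[OF forms_in_loci(7), where S = T]
        discriminant_locus_orbit[OF forms_in_loci(8), where S = T] by auto
    then show ?thesis using orbit_trans[OF P07_orbit_cyclic_form cyclic] by simp
  next
    case zero
    then show ?thesis using T(2) by (simp add: singular_locus_def) (simp add: mult_table_zero area_def)
  qed (use T(2) discriminant_locus_orbit[OF forms_in_loci(2)] trace_locus_orbit[OF P_in_loci(7)]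
      singular_locus_orbit[OF forms_in_loci(9)] discriminant_locus_orbit[OF forms_in_loci(11)] in blast)+
next
  fix T S assume "T \<in> trace_locus \<union> (singular_locus \<union> discriminant_locus)" "S \<in> orbit T"
  then show "S \<in> trace_locus \<union> (singular_locus \<union> discriminant_locus)"
    using trace_locus_orbit singular_locus_orbit discriminant_locus_orbit by (metis Un_iff)
qed (simp_all add: P_in_variety locus_closed zariski_closed_Un P07_notin)

section \<open>Separation of the five closures and assembly of the components\<close>

lemma five_incomparable_sets:
  assumes "w1 \<in> A1" "w1 \<notin> A2" "w1 \<notin> A3" "w1 \<notin> A4" "w1 \<notin> A5"
    and "w2 \<notin> A1" "w2 \<in> A2" "w2 \<notin> A3" "w2 \<notin> A4" "w2 \<notin> A5"
    and "w3 \<notin> A1" "w3 \<notin> A2" "w3 \<in> A3" "w3 \<notin> A4" "w3 \<notin> A5"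
    and "w4 \<notin> A1" "w4 \<notin> A2" "w4 \<notin> A3" "w4 \<in> A4" "w4 \<notin> A5"
    and "w5 \<notin> A1" "w5 \<notin> A2" "w5 \<notin> A3" "w5 \<notin> A4" "w5 \<in> A5"
  shows "card {A1, A2, A3, A4, A5} = 5"
    and "A \<in> {A1, A2, A3, A4, A5} \<Longrightarrow> B \<in> {A1, A2, A3, A4, A5} \<Longrightarrow> A \<subseteq> B \<Longrightarrow> A = B"
proof -
  have "A1 \<noteq> A2" "A1 \<noteq> A3" "A1 \<noteq> A4" "A1 \<noteq> A5" "A2 \<noteq> A3" "A2 \<noteq> A4" "A2 \<noteq> A5"
    "A3 \<noteq> A4" "A3 \<noteq> A5" "A4 \<noteq> A5"
    using assms by metis+
  then show "card {A1, A2, A3, A4, A5} = 5" by simp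
  show "A = B" if "A \<in> {A1, A2, A3, A4, A5}" "B \<in> {A1, A2, A3, A4, A5}" "A \<subseteq> B"
    using that assms by (elim insertE emptyE; simp; metis subsetD)
qed

theorem theorem68:
  shows "irreducible_components (subtopology zariski pre_poisson_variety) =
           {zariski closure_of (orbit P07),
            zariski closure_of (orbit P08),
            zariski closure_of (orbit P10),
            zariski closure_of (\<Union>\<alpha>. orbit (P05 \<alpha>)),
            zariski closure_of (\<Union>\<alpha>. orbit (P06 \<alpha>))}
       \<and> card (irreducible_components (subtopology zariski pre_poisson_variety)) = 5
       \<and> rigid P07 \<and> rigid P08 \<and> rigid P10"
proof -
  define S5 S6 where "S5 = (\<Union>\<alpha>. orbit (P05 \<alpha>))" and "S6 = (\<Union>\<alpha>. orbit (P06 \<alpha>))"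
  let ?X = "subtopology zariski pre_poisson_variety"
  let ?cl = "\<lambda>S. zariski closure_of S"
  let ?\<C> = "{?cl (orbit P07), ?cl (orbit P08), ?cl (orbit P10), ?cl S5, ?cl S6}"
  have X: "closedin zariski pre_poisson_variety"
    by (simp add: closedin_zariski zariski_closed_variety)
  have irr: "irreducible_in zariski (orbit P07)" "irreducible_in zariski (orbit P08)"
    "irreducible_in zariski (orbit P10)" "irreducible_in zariski S5" "irreducible_in zariski S6"
    unfolding S5_def S6_def
    by (simp_all add: irreducible_orbit)
      (rule irreducible_orbit_family, rule P05_def P06_def, (intro polyfun_intros; assumption)+)+
  have sub: "orbit P07 \<subseteq> pre_poisson_variety" "orbit P08 \<subseteq> pre_poisson_variety"
    "orbit P10 \<subseteq> pre_poisson_variety" "S5 \<subseteq> pre_poisson_variety" "S6 \<subseteq> pre_poisson_variety"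
    unfolding S5_def S6_def using variety_orbit P_in_variety by (safe, metis+)
  have component: "irreducible_in ?X (?cl S) \<and> closedin ?X (?cl S)"
    if "irreducible_in zariski S" "S \<subseteq> pre_poisson_variety" for S
    using irreducible_in_closure_of[OF that(1)] closure_zariski_subset[OF zariski_closed_variety that(2)]
    by (simp add: irreducible_in_closed_subtopology[OF X] closedin_closed_subtopology[OF X])
  have cl: "?cl (orbit P) \<subseteq> Z" if "P \<in> Z" "zariski_closed Z" "\<And>T S. T \<in> Z \<Longrightarrow> S \<in> orbit T \<Longrightarrow> S \<in> Z" for P Z
    using that by (intro closure_zariski_subset) blast+
  have cl_family: "?cl (\<Union>\<alpha>. orbit (P \<alpha>)) \<subseteq> Z"
    if "\<And>\<alpha>::complex. P \<alpha> \<in> Z" "zariski_closed Z" "\<And>T S. T \<in> Z \<Longrightarrow> S \<in> orbit T \<Longrightarrow> S \<in> Z" for P Z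
    using that by (intro closure_zariski_subset) blast+
  \<comment> \<open>In each bound except that of \<open>P10\<close>,
    \<open>annihilator_locus\<close> keeps out \<open>P10\<close> and the other locus keeps out the
    remaining three samples. For \<open>P10\<close>, \<open>discriminant_locus\<close> keeps out
    \<open>P07\<close> and commutativity the other three.\<close>
  have le7: "?cl (orbit P07) \<subseteq> commutative_locus" "?cl (orbit P07) \<subseteq> annihilator_locus"
    by (rule cl, rule P_in_loci, rule locus_closed, rule commutative_locus_orbit annihilator_locus_orbit, assumption+)+
  have le8: "?cl (orbit P08) \<subseteq> trace_locus" "?cl (orbit P08) \<subseteq> annihilator_locus"
    by (rule cl, rule P_in_loci, rule locus_closed, rule trace_locus_orbit annihilator_locus_orbit, assumption+)+
  have le10: "?cl (orbit P10) \<subseteq> commutative_locus" "?cl (orbit P10) \<subseteq> discriminant_locus"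
    by (rule cl, rule P_in_loci, rule locus_closed, rule commutative_locus_orbit discriminant_locus_orbit, assumption+)+
  have le5: "?cl S5 \<subseteq> singular_locus" "?cl S5 \<subseteq> annihilator_locus" unfolding S5_def
    by (rule cl_family, rule P_in_loci, rule locus_closed, rule singular_locus_orbit annihilator_locus_orbit, assumption+)+
  have le6: "?cl S6 \<subseteq> discriminant_locus" "?cl S6 \<subseteq> annihilator_locus" unfolding S6_def
    by (rule cl_family, rule P_in_loci, rule locus_closed, rule discriminant_locus_orbit annihilator_locus_orbit, assumption+)+
  have self: "P \<in> ?cl S" if "P \<in> S" "S \<subseteq> pre_poisson_variety" for P S
  proof -
    have "S \<subseteq> topspace zariski" using that(2) variety_subset by (simp add: topspace_zariski)
    from subsetD[OF closure_of_subset[OF this] that(1)] show ?thesis .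
  qed
  have "P05 1 \<in> S5" "P06 0 \<in> S6"
    unfolding S5_def S6_def by (rule UN_I[OF UNIV_I], rule orbit_refl, simp)+
  then have mem: "P07 \<in> ?cl (orbit P07)" "P08 \<in> ?cl (orbit P08)" "P10 \<in> ?cl (orbit P10)"
    "P05 1 \<in> ?cl S5" "P06 0 \<in> ?cl S6"
    by (simp_all add: self sub orbit_refl)
  note incomparable = five_incomparable_sets[of P07 "?cl (orbit P07)" "?cl (orbit P08)" "?cl (orbit P10)"
      "?cl S5" "?cl S6" P08 P10 "P05 1" "P06 0",
      OF mem(1) contra_subsetD[OF le8(1) P07_notin(1)] contra_subsetD[OF le10(2) P07_notin(3)]
        contra_subsetD[OF le5(1) P07_notin(2)] contra_subsetD[OF le6(1) P07_notin(3)]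
        contra_subsetD[OF le7(1) P08_notin(1)] mem(2) contra_subsetD[OF le10(1) P08_notin(1)]
        contra_subsetD[OF le5(1) P08_notin(2)] contra_subsetD[OF le6(1) P08_notin(3)]
        contra_subsetD[OF le7(2) P10_notin] contra_subsetD[OF le8(2) P10_notin] mem(3)
        contra_subsetD[OF le5(2) P10_notin] contra_subsetD[OF le6(2) P10_notin]
        contra_subsetD[OF le7(1) P05_notin(1)] contra_subsetD[OF le8(1) P05_notin(2)]
        contra_subsetD[OF le10(1) P05_notin(1)] mem(4) contra_subsetD[OF le6(1) P05_notin(3)]
        contra_subsetD[OF le7(1) P06_notin(1)] contra_subsetD[OF le8(1) P06_notin(2)]
        contra_subsetD[OF le10(1) P06_notin(1)] contra_subsetD[OF le5(1) P06_notin(3)] mem(5)]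
  have "irreducible_components ?X = ?\<C>"
  proof (rule irreducible_components_eqI)
    show "finite ?\<C>" by simp
    show "irreducible_in ?X C" "closedin ?X C" if "C \<in> ?\<C>" for C
      using that component[OF irr(1) sub(1)] component[OF irr(2) sub(2)] component[OF irr(3) sub(3)]
        component[OF irr(4) sub(4)] component[OF irr(5) sub(5)] by (elim insertE emptyE; simp)+
    show "topspace ?X \<subseteq> \<Union>?\<C>"
    proof
      fix T assume "T \<in> topspace ?X"
      then have "T \<in> pre_poisson_variety" by simp
      from closure_cover[OF this] show "T \<in> \<Union>?\<C>" by (simp add: S5_def S6_def)
    qed
  qed (rule incomparable(2))
  then show ?thesis
    using incomparable(1) rigid_P07 rigid_P08 rigid_P10 by (simp only: S5_def S6_def simp_thms)
qed

end
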